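(* Let $p\ge3$ be a prime and let $T|S$ be a finite, purely ramified extension of discrete valuation rings of residue characteristic $p$, with fields of fractions $L|K$, such that $L|K$ is Galois with group $G=\langle\sigma\rangle$ cyclic of order $p$. Let $t$ generate the maximal ideal of $T$, let $s=\mathrm{N}_{L|K}(t)$, let $b=\mathrm{val}_t(t^\sigma-t)-1$ and assume $b\ge1$; write $b=p\underline b+\overline b$ with $\overline b\in[0,p-1]$ and assume $\mathrm{val}_s(p)\ge b-\underline b$. Then the Wedderburn embedding $\omega: T\wr G\to\Gamma:=\mathrm{End}_S T$ restricts to an isomorphism of $S$-algebras \[ T\wr G\;\xrightarrow{\ \sim\ }\;\Lambda^{\mathrm{D}}\subseteq\Lambda\subseteq\Gamma, \] i.e. its image is exactly $\Lambda^{\mathrm{D}}$.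
   Context: "Purely ramified" means totally ramified with trivial residue field extension. The twisted group ring $T\wr G$ is $\{\sum_{\rho\in G}\rho y_\rho: y_\rho\in T\}$ with multiplication induced by $(\rho y)(\tau z)=(\rho\tau)(y^\tau z)$. Maps are written on the right and composed left to right ($x(fg)=(xf)g$). The Wedderburn embedding $\omega$ is the $S$-algebra map with $y\omega=\dot y:x\mapsto xy$ for $y\in T$ and $\rho\omega=(x\mapsto x^\rho)$ for $\rho\in G$. Let $\Lambda:=\{f\in\Gamma: (Tt^i)f\subseteq Tt^i\text{ for all }i\ge0\}$, $\dot t=t\omega$, and \[ \Lambda^{\mathrm{D}}:=\Big\{u\in\Lambda:\ \sum_{j=0}^{i}(-1)^j\tbinom{i}{j}\dot t^{\,j}u\,\dot t^{\,i-j}\in\dot t^{(1+b)i}\Lambda\ \text{for all } i\in[0,p-1]\Big\}. \] *)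

theory Defs
  imports
    "HOL-Algebra.Algebra"
    "HOL-Algebra.Algebraic_Closure_Type"
    "HOL-Library.Extended_Nat"
    "HOL-Computational_Algebra.Primes"
begin

text \<open>
  The big field \<open>L\<close> is a type of class \<^class>\<open>field\<close>; its subrings \<open>S\<close>, \<open>T\<close> and its
  subfield \<open>K\<close> are sets of elements of that type, viewed as ring records by restricting the
  carrier.
\<close>

definition subring_rec :: "'a::field set \<Rightarrow> 'a ring" where
  "subring_rec R = ring_of_type_algebra\<lparr>carrier := R\<rparr>"

section \<open>Discrete valuation rings\<close>

definition dvr :: "'a::field set \<Rightarrow> bool" where
  "dvr R \<longleftrightarrow> principal_domain (subring_rec R) \<and>
     (\<exists>!P. primeideal P (subring_rec R) \<and> P \<noteq> {0})"

definition max_ideal :: "'a::field set \<Rightarrow> 'a set" where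
  "max_ideal R = (THE M. maximalideal M (subring_rec R))"

definition uniformizer :: "'a::field set \<Rightarrow> 'a \<Rightarrow> bool" where
  "uniformizer R r \<longleftrightarrow> r \<in> R \<and> max_ideal R = PIdl\<^bsub>subring_rec R\<^esub> r"

text \<open>
  The valuation at a uniformizer \<open>r\<close> of \<open>R\<close>. Only values at elements of \<open>R\<close> are meaningful;
  the value at 0 is \<open>\<infinity>\<close>.
\<close>

definition val :: "'a::field set \<Rightarrow> 'a \<Rightarrow> 'a \<Rightarrow> enat" where
  "val R r x = (SUP n\<in>{n. \<exists>y\<in>R. x = r ^ n * y}. enat n)"

text \<open>The kernel of the map from the integers to the residue field is generated by \<open>p\<close>.\<close>

definition residue_char :: "'a::field set \<Rightarrow> nat \<Rightarrow> bool" where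
  "residue_char R p \<longleftrightarrow> (\<forall>n::nat. of_nat n \<in> max_ideal R \<longleftrightarrow> p dvd n)"

definition fraction_field :: "'a::field set \<Rightarrow> 'a set" where
  "fraction_field R = {x / y | x y. x \<in> R \<and> y \<in> R \<and> y \<noteq> 0}"

section \<open>Extensions\<close>

definition finite_over :: "'a::field set \<Rightarrow> 'a set \<Rightarrow> bool" where
  "finite_over S T \<longleftrightarrow>
     (\<exists>B. finite B \<and> B \<subseteq> T \<and> (\<forall>x\<in>T. \<exists>c\<in>B \<rightarrow> S. x = (\<Sum>b\<in>B. c b * b)))"

text \<open>
  Here \<open>T\<close> is meant to have the whole type as its field of fractions. Totally ramified: the
  ramification index, i.e. the \<open>T\<close>-valuation of a uniformizer of \<open>S\<close>, is the degree of the
  extension of the fields of fractions.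
\<close>

definition totally_ramified :: "'a::field set \<Rightarrow> 'a set \<Rightarrow> bool" where
  "totally_ramified S T \<longleftrightarrow>
     (\<exists>n. ring.dimension ring_of_type_algebra n (fraction_field S) (UNIV :: 'a set) \<and>
          (\<forall>r q. uniformizer S r \<and> uniformizer T q \<longrightarrow> val T q r = enat n))"

definition trivial_residue_extension :: "'a::field set \<Rightarrow> 'a set \<Rightarrow> bool" where
  "trivial_residue_extension S T \<longleftrightarrow>
     max_ideal T \<inter> S = max_ideal S \<and> (\<forall>x\<in>T. \<exists>y\<in>S. x - y \<in> max_ideal T)"

definition purely_ramified :: "'a::field set \<Rightarrow> 'a set \<Rightarrow> bool" where
  "purely_ramified S T \<longleftrightarrow> totally_ramified S T \<and> trivial_residue_extension S T"

text \<open>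
  Automorphisms act on the right and are composed left to right, so the group product
  of \<open>\<rho>\<close> and \<open>\<tau>\<close> is \<open>\<tau> \<circ> \<rho>\<close>; what is written \<open>x\<^sup>\<rho>\<close> in right notation is \<open>\<rho> x\<close>.
\<close>

definition galois_group :: "'a::field set \<Rightarrow> ('a \<Rightarrow> 'a) monoid" where
  "galois_group K =
     \<lparr>carrier = {\<rho> \<in> ring_iso ring_of_type_algebra ring_of_type_algebra. \<forall>x\<in>K. \<rho> x = x},
      monoid.mult = (\<lambda>\<rho> \<tau>. \<tau> \<circ> \<rho>),
      one = id\<rparr>"

text \<open>The whole type is a (finite) Galois extension of \<open>K\<close>.\<close>

definition galois_over :: "'a::field set \<Rightarrow> bool" where
  "galois_over K \<longleftrightarrow> subfield K ring_of_type_algebra \<and>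
     ring.finite_dimension ring_of_type_algebra K (UNIV :: 'a set) \<and>
     {x. \<forall>\<rho>\<in>carrier (galois_group K). \<rho> x = x} = K"

definition galois_norm :: "'a::field set \<Rightarrow> 'a \<Rightarrow> 'a" where
  "galois_norm K x = (\<Prod>\<rho>\<in>carrier (galois_group K). \<rho> x)"

section \<open>Associative algebras\<close>

definition assoc_algebra :: "('a, 'm) ring_scheme \<Rightarrow> ('a, 'b, 'n) module_scheme \<Rightarrow> bool" where
  "assoc_algebra R A \<longleftrightarrow> ring A \<and> module R A \<and>
     (\<forall>r\<in>carrier R. \<forall>x\<in>carrier A. \<forall>y\<in>carrier A.
        (r \<odot>\<^bsub>A\<^esub> x) \<otimes>\<^bsub>A\<^esub> y = r \<odot>\<^bsub>A\<^esub> (x \<otimes>\<^bsub>A\<^esub> y) \<and>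
        x \<otimes>\<^bsub>A\<^esub> (r \<odot>\<^bsub>A\<^esub> y) = r \<odot>\<^bsub>A\<^esub> (x \<otimes>\<^bsub>A\<^esub> y))"

definition algebra_hom ::
  "('a, 'm) ring_scheme \<Rightarrow> ('a, 'b, 'n) module_scheme \<Rightarrow> ('a, 'c, 'k) module_scheme \<Rightarrow>
   ('b \<Rightarrow> 'c) set" where
  "algebra_hom R A B = {h \<in> ring_hom A B.
     \<forall>r\<in>carrier R. \<forall>x\<in>carrier A. h (r \<odot>\<^bsub>A\<^esub> x) = r \<odot>\<^bsub>B\<^esub> h x}"

definition algebra_iso ::
  "('a, 'm) ring_scheme \<Rightarrow> ('a, 'b, 'n) module_scheme \<Rightarrow> ('a, 'c, 'k) module_scheme \<Rightarrow>
   ('b \<Rightarrow> 'c) set" where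
  "algebra_iso R A B = {h \<in> algebra_hom R A B. bij_betw h (carrier A) (carrier B)}"

section \<open>The twisted group ring, the endomorphism ring and the Wedderburn embedding\<close>

text \<open>
  The formal sum of the \<open>\<rho> y\<^sub>\<rho>\<close> is the function \<open>\<rho> \<mapsto> y\<^sub>\<rho>\<close> on the group, undefined outside it.
  By the rule \<open>(\<rho> y)(\<tau> z) = (\<rho>\<tau>)(y\<^sup>\<tau> z)\<close>, the coefficient of a product at \<open>\<kappa>\<close> is the sum
  of the \<open>y\<^sub>\<rho>\<^sup>\<tau> z\<^sub>\<tau>\<close> over \<open>\<rho>\<tau> = \<kappa>\<close> (see \<open>twisted_single_mult\<close> below).
\<close>

definition twisted_group_ring ::
  "'a::field set \<Rightarrow> ('a \<Rightarrow> 'a) monoid \<Rightarrow> ('a, ('a \<Rightarrow> 'a) \<Rightarrow> 'a) module" where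
  "twisted_group_ring T G =
     \<lparr>carrier = carrier G \<rightarrow>\<^sub>E T,
      monoid.mult = (\<lambda>y z. \<lambda>\<kappa>\<in>carrier G.
        \<Sum>(\<rho>, \<tau>)\<in>{(\<rho>, \<tau>) \<in> carrier G \<times> carrier G. \<rho> \<otimes>\<^bsub>G\<^esub> \<tau> = \<kappa>}. \<tau> (y \<rho>) * z \<tau>),
      one = (\<lambda>\<rho>\<in>carrier G. if \<rho> = \<one>\<^bsub>G\<^esub> then 1 else 0),
      ring.zero = (\<lambda>\<rho>\<in>carrier G. 0),
      add = (\<lambda>y z. \<lambda>\<rho>\<in>carrier G. y \<rho> + z \<rho>),
      module.smult = (\<lambda>r y. \<lambda>\<rho>\<in>carrier G. r * y \<rho>)\<rparr>"

text \<open>\<open>S\<close>-linear endomorphisms of \<open>T\<close>, undefined outside \<open>T\<close>, composed left to right.\<close>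

definition End_alg :: "'a::field set \<Rightarrow> 'a set \<Rightarrow> ('a, 'a \<Rightarrow> 'a) module" where
  "End_alg S T =
     \<lparr>carrier = {f \<in> T \<rightarrow>\<^sub>E T. (\<forall>x\<in>T. \<forall>y\<in>T. f (x + y) = f x + f y) \<and>
                              (\<forall>r\<in>S. \<forall>x\<in>T. f (r * x) = r * f x)},
      monoid.mult = (\<lambda>f g. compose T g f),
      one = (\<lambda>x\<in>T. x),
      ring.zero = (\<lambda>x\<in>T. 0),
      add = (\<lambda>f g. \<lambda>x\<in>T. f x + g x),
      module.smult = (\<lambda>r f. \<lambda>x\<in>T. r * f x)\<rparr>"

definition dot :: "'a::field set \<Rightarrow> 'a \<Rightarrow> ('a \<Rightarrow> 'a)" where
  "dot T y = (\<lambda>x\<in>T. x * y)"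

text \<open>
  The formal sum of the \<open>\<rho> y\<^sub>\<rho>\<close> is sent to \<open>x \<mapsto> (\<Sum>\<rho>. x\<^sup>\<rho> y\<^sub>\<rho>)\<close>; the values on the generators
  are computed in \<open>wedderburn_coeff\<close> and \<open>wedderburn_group\<close> below.
\<close>

definition wedderburn ::
  "'a::field set \<Rightarrow> ('a \<Rightarrow> 'a) monoid \<Rightarrow> (('a \<Rightarrow> 'a) \<Rightarrow> 'a) \<Rightarrow> ('a \<Rightarrow> 'a)" where
  "wedderburn T G y = (\<lambda>x\<in>T. \<Sum>\<rho>\<in>carrier G. \<rho> x * y \<rho>)"

definition twisted_single :: "('a \<Rightarrow> 'a) monoid \<Rightarrow> ('a \<Rightarrow> 'a) \<Rightarrow> 'a \<Rightarrow> (('a \<Rightarrow> 'a) \<Rightarrow> 'a::field)" where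
  "twisted_single G \<rho> y = (\<lambda>\<tau>\<in>carrier G. if \<tau> = \<rho> then y else 0)"

lemma twisted_single_mult:
  fixes K :: "'a::field set" and T :: "'a set"
  assumes "finite (carrier (galois_group K))"
    and "\<rho> \<in> carrier (galois_group K)" "\<tau> \<in> carrier (galois_group K)"
    and "\<rho> \<otimes>\<^bsub>galois_group K\<^esub> \<tau> \<in> carrier (galois_group K)"
  shows "twisted_single (galois_group K) \<rho> y
           \<otimes>\<^bsub>twisted_group_ring T (galois_group K)\<^esub> twisted_single (galois_group K) \<tau> z =
         twisted_single (galois_group K) (\<rho> \<otimes>\<^bsub>galois_group K\<^esub> \<tau>) (\<tau> y * z)"
proof -
  let ?G = "galois_group K"
  let ?P = "\<lambda>\<kappa>. {(\<alpha>, \<beta>) \<in> carrier ?G \<times> carrier ?G. \<alpha> \<otimes>\<^bsub>?G\<^esub> \<beta> = \<kappa>}"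
  have zero: "\<beta> 0 = 0" if "\<beta> \<in> carrier ?G" for \<beta>
  proof -
    have "\<beta> (x + y) = \<beta> x + \<beta> y" for x y
      using that
      by (simp add: galois_group_def ring_iso_def ring_hom_def ring_of_type_algebra_def)
    from this[of 0 0] show ?thesis
      by (metis add_0 add_cancel_right_right)
  qed
  have "(\<Sum>(\<alpha>, \<beta>)\<in>?P \<kappa>. \<beta> (twisted_single ?G \<rho> y \<alpha>) * twisted_single ?G \<tau> z \<beta>) =
        (if \<kappa> = \<rho> \<otimes>\<^bsub>?G\<^esub> \<tau> then \<tau> y * z else 0)" for \<kappa>
  proof -
    have fin: "finite (?P \<kappa>)"
      by (rule finite_subset[of _ "carrier ?G \<times> carrier ?G"]) (use assms(1) in auto)
    have "(\<Sum>(\<alpha>, \<beta>)\<in>?P \<kappa>. \<beta> (twisted_single ?G \<rho> y \<alpha>) * twisted_single ?G \<tau> z \<beta>) =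
          (\<Sum>ab\<in>?P \<kappa>. if ab = (\<rho>, \<tau>) then \<tau> y * z else 0)"
      by (rule sum.cong) (auto simp: twisted_single_def zero split: if_splits)
    also have "\<dots> = (if \<kappa> = \<rho> \<otimes>\<^bsub>?G\<^esub> \<tau> then \<tau> y * z else 0)"
      using fin assms(2,3) by (auto simp: sum.delta)
    finally show ?thesis .
  qed
  then show ?thesis
    by (simp add: twisted_group_ring_def twisted_single_def[of _ "_ \<otimes>\<^bsub>_\<^esub> _"])
qed

lemma wedderburn_coeff:
  assumes "finite (carrier (galois_group K))" and "id \<in> carrier (galois_group K)"
  shows "wedderburn T (galois_group K)
           (twisted_single (galois_group K) \<one>\<^bsub>galois_group K\<^esub> y) = dot T y"
proof -
  have "\<one>\<^bsub>galois_group K\<^esub> = id" by (simp add: galois_group_def)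
  moreover have "(\<Sum>\<rho>\<in>carrier (galois_group K).
      \<rho> x * twisted_single (galois_group K) id y \<rho>) = x * y" for x
    using assms by (simp add: twisted_single_def if_distrib[of "\<lambda>u. _ * u"] cong: if_cong)
  ultimately show ?thesis by (simp add: wedderburn_def dot_def)
qed

lemma wedderburn_group:
  assumes "finite (carrier (galois_group K))" and "\<rho> \<in> carrier (galois_group K)"
  shows "wedderburn T (galois_group K) (twisted_single (galois_group K) \<rho> 1) = (\<lambda>x\<in>T. \<rho> x)"
  using assms
  by (simp add: wedderburn_def twisted_single_def if_distrib[of "\<lambda>u. _ * u"] cong: if_cong)

section \<open>The orders in the endomorphism ring\<close>

definition Lam :: "'a::field set \<Rightarrow> 'a set \<Rightarrow> 'a \<Rightarrow> ('a \<Rightarrow> 'a) set" where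
  "Lam S T t = {f \<in> carrier (End_alg S T).
     \<forall>i::nat. f ` {x * t ^ i | x. x \<in> T} \<subseteq> {x * t ^ i | x. x \<in> T}}"

definition LamD :: "'a::field set \<Rightarrow> 'a set \<Rightarrow> 'a \<Rightarrow> nat \<Rightarrow> nat \<Rightarrow> ('a \<Rightarrow> 'a) set" where
  "LamD S T t b p = {u \<in> Lam S T t. \<forall>i\<in>{0..p - 1}.
     (\<Oplus>\<^bsub>End_alg S T\<^esub>j\<in>{0..i}. add_pow (End_alg S T) ((-1) ^ j * int (i choose j))
        (dot T t [^]\<^bsub>End_alg S T\<^esub> j \<otimes>\<^bsub>End_alg S T\<^esub> u \<otimes>\<^bsub>End_alg S T\<^esub>
         dot T t [^]\<^bsub>End_alg S T\<^esub> (i - j)))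
     \<in> {dot T t [^]\<^bsub>End_alg S T\<^esub> ((1 + b) * i) \<otimes>\<^bsub>End_alg S T\<^esub> v | v. v \<in> Lam S T t}}"

end

theory Submission
  imports Defs
begin

text \<open>
  On \<open>\<rho> y\<close> the iterated commutator with \<open>t\<close> of the definition of \<open>LamD\<close> is
  \<open>x \<mapsto> x\<^sup>\<rho> y (t - t\<^sup>\<rho>)\<^sup>i\<close>, and \<open>t - t\<^sup>\<rho> = t\<^bsup>b+1\<^esup> a\<^sub>\<rho>\<close> with \<open>a\<^sub>\<rho>\<close> in \<open>T\<close>; so the image of the
  Wedderburn embedding lies in \<open>LamD\<close>. Conversely, evaluating the conditions on \<open>u\<close> at \<open>1\<close>
  prescribes the moments \<open>\<Sum>\<^sub>\<rho> a\<^sub>\<rho>\<^sup>i y\<^sub>\<rho>\<close>, for \<open>i < p\<close>, of a preimage \<open>y\<close> of \<open>u\<close> as elements of \<open>T\<close>.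
  Since \<open>b\<close> is the only ramification break, the \<open>a\<^sub>\<rho>\<close> are pairwise distinct modulo \<open>t\<close>, so the
  Vandermonde system can be solved in \<open>T\<close>. The solution has the same values as \<open>u\<close> at
  \<open>1, t, \<dots>, t\<^bsup>p-1\<^esup>\<close>, which span the big field over \<open>K\<close>.
\<close>

section \<open>Lagrange interpolation\<close>

text \<open>The nodes form a family indexed by \<open>A\<close>, because they will be attached to
  automorphisms. Each factor (X - z j) / (z i - z j) is written by its two coefficients, so that
  integrality can be read off from \<open>z j\<close> and the inverse of
  \<open>z i - z j\<close>.\<close>

definition lagrange_poly :: "('i \<Rightarrow> 'a::field) \<Rightarrow> 'i set \<Rightarrow> 'i \<Rightarrow> 'a poly" where
  "lagrange_poly z A i = (\<Prod>j\<in>A - {i}. [:- z j / (z i - z j), 1 / (z i - z j):])"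

lemma poly_lagrange_poly:
  assumes "finite A" and "inj_on z A" and "i \<in> A" and "j \<in> A"
  shows "poly (lagrange_poly z A i) (z j) = (if i = j then 1 else 0)"
proof (cases "i = j")
  case True
  have "z j / (z j - z k) - z k / (z j - z k) = 1" if "k \<in> A - {j}" for k
  proof -
    have "z j \<noteq> z k" using assms that by (auto dest: inj_onD)
    then show ?thesis by (subst diff_divide_distrib[symmetric]) simp
  qed
  with True show ?thesis
    by (auto simp: lagrange_poly_def poly_prod intro!: prod.neutral)
next
  case False
  then show ?thesis
    using assms by (auto simp: lagrange_poly_def poly_prod intro!: bexI[of _ j])
qed

lemma degree_lagrange_poly_less:
  assumes "finite A" and "i \<in> A"
  shows "degree (lagrange_poly z A i) < card A"
proof -
  have "degree (lagrange_poly z A i) \<le> sum (degree \<circ> (\<lambda>j. [:- z j / (z i - z j), 1 / (z i - z j):])) (A - {i})"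
    unfolding lagrange_poly_def by (rule degree_prod_sum_le) (use assms in simp)
  also have "\<dots> \<le> (\<Sum>j\<in>A - {i}. 1)"
    by (rule sum_mono) simp
  also have "\<dots> = card A - 1"
    using assms by simp
  also have "\<dots> < card A"
    using assms by (metis card_gt_0_iff diff_less empty_iff zero_less_one)
  finally show ?thesis .
qed

lemma poly_eqI_interpolation:
  fixes P Q :: "'a::field poly"
  assumes "finite A" and "inj_on z A" and "degree P < card A" and "degree Q < card A"
    and "\<And>i. i \<in> A \<Longrightarrow> poly P (z i) = poly Q (z i)"
  shows "P = Q"
  using assms by (intro poly_eqI_degree[of "z ` A"]) (auto simp: card_image)

lemma degree_interpolation_less:
  fixes c :: "'i \<Rightarrow> 'a::field"
  assumes "finite A" and "A \<noteq> {}"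
  shows "degree (\<Sum>i\<in>A. smult (c i) (lagrange_poly z A i)) < card A"
proof (rule degree_sum_less)
  show "0 < card A" using assms by (simp add: card_gt_0_iff)
  show "degree (smult (c i) (lagrange_poly z A i)) < card A" if "i \<in> A" for i
    by (rule le_less_trans[OF degree_smult_le degree_lagrange_poly_less[OF assms(1) that]])
qed

lemma poly_interpolation:
  assumes "finite A" and "inj_on z A" and "j \<in> A"
  shows "poly (\<Sum>i\<in>A. smult (c i) (lagrange_poly z A i)) (z j) = c j"
  using assms by (simp add: poly_sum poly_lagrange_poly if_distrib[of "\<lambda>u. _ * u"] cong: if_cong)

text \<open>As \<open>m\<close> is below the number of nodes, interpolating the values
  \<open>z i ^ m\<close> gives back the monomial X^m; compare the coefficients at X^k.\<close>

lemma coeff_lagrange_poly_moments: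
  assumes "finite A" and "inj_on z A" and "m < card A"
  shows "(\<Sum>i\<in>A. z i ^ m * coeff (lagrange_poly z A i) k) = (if k = m then 1 else 0)"
proof -
  have "A \<noteq> {}" using assms by auto
  have "(\<Sum>i\<in>A. smult (z i ^ m) (lagrange_poly z A i)) = monom 1 m"
    using assms \<open>A \<noteq> {}\<close>
    by (intro poly_eqI_interpolation[OF assms(1,2)] degree_interpolation_less)
      (auto simp: poly_interpolation[OF assms(1,2)] poly_monom degree_monom_eq)
  from arg_cong[OF this, of "\<lambda>P. coeff P k"] show ?thesis
    by (simp add: coeff_sum)
qed

text \<open>The next two lemmas say that the coefficient matrix of the Lagrange polynomials is the
  two-sided inverse of the Vandermonde matrix.\<close>

lemma vandermonde_solve:
  fixes z :: "'i \<Rightarrow> 'a::field"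
  assumes "finite A" and "inj_on z A" and "m < card A"
  shows "(\<Sum>i\<in>A. z i ^ m * (\<Sum>k<card A. coeff (lagrange_poly z A i) k * w k)) = w m"
proof -
  have "(\<Sum>i\<in>A. z i ^ m * (\<Sum>k<card A. coeff (lagrange_poly z A i) k * w k)) =
      (\<Sum>k<card A. (\<Sum>i\<in>A. z i ^ m * coeff (lagrange_poly z A i) k) * w k)"
    unfolding sum_distrib_left sum_distrib_right by (subst sum.swap) (simp add: mult.assoc)
  also have "\<dots> = (\<Sum>k<card A. if k = m then w k else 0)"
    using assms by (intro sum.cong) (auto simp: coeff_lagrange_poly_moments)
  also have "\<dots> = w m"
    using assms by simp
  finally show ?thesis .
qed

lemma vandermonde_recover:
  fixes z :: "'i \<Rightarrow> 'a::field"
  assumes "finite A" and "inj_on z A" and "i \<in> A"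
  shows "(\<Sum>k<card A. coeff (lagrange_poly z A i) k * (\<Sum>j\<in>A. z j ^ k * y j)) = y i"
proof -
  have deg: "degree (lagrange_poly z A i) < card A"
    using assms by (simp add: degree_lagrange_poly_less)
  have "(\<Sum>k<card A. coeff (lagrange_poly z A i) k * (\<Sum>j\<in>A. z j ^ k * y j)) =
      (\<Sum>j\<in>A. (\<Sum>k<card A. coeff (lagrange_poly z A i) k * z j ^ k) * y j)"
    unfolding sum_distrib_left sum_distrib_right by (subst sum.swap) (simp add: mult.assoc)
  also have "\<dots> = (\<Sum>j\<in>A. poly (lagrange_poly z A i) (z j) * y j)"
  proof -
    have "(\<Sum>k<card A. coeff (lagrange_poly z A i) k * x ^ k) = poly (lagrange_poly z A i) x" for x
      unfolding poly_altdef using deg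
      by (intro sum.mono_neutral_right) (auto simp: coeff_eq_0)
    then show ?thesis by simp
  qed
  also have "\<dots> = (\<Sum>j\<in>A. if i = j then y j else 0)"
    using assms by (intro sum.cong) (auto simp: poly_lagrange_poly)
  also have "\<dots> = y i"
    using assms by simp
  finally show ?thesis .
qed

section \<open>Valuation rings\<close>

text \<open>Elementary axioms for a discrete valuation ring inside its field of fractions, phrased
  by quotients: by \<open>inverse_mem\<close> an element not divisible by \<open>t\<close> is a
  unit, and by \<open>separated\<close> no nonzero element is divisible by all powers of
  \<open>t\<close>.\<close>

locale valuation_ring =
  fixes T :: "'a::field set" and t :: 'a
  assumes one_mem: "1 \<in> T"
    and diff_mem: "x \<in> T \<Longrightarrow> y \<in> T \<Longrightarrow> x - y \<in> T"
    and mult_mem: "x \<in> T \<Longrightarrow> y \<in> T \<Longrightarrow> x * y \<in> T"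
    and t_mem: "t \<in> T"
    and t_nonzero: "t \<noteq> 0"
    and t_nonunit: "1 / t \<notin> T"
    and inverse_mem: "x \<in> T \<Longrightarrow> x / t \<notin> T \<Longrightarrow> 1 / x \<in> T"
    and separated: "x \<noteq> 0 \<Longrightarrow> \<exists>n. x / t ^ n \<notin> T"
    and fractions: "\<exists>a\<in>T. \<exists>b\<in>T. x = a / b"
begin

lemma zero_mem: "0 \<in> T"
  using diff_mem[OF one_mem one_mem] by simp

lemma uminus_mem: "x \<in> T \<Longrightarrow> - x \<in> T"
  using diff_mem[OF zero_mem] by fastforce

lemma add_mem: "x \<in> T \<Longrightarrow> y \<in> T \<Longrightarrow> x + y \<in> T"
  using diff_mem[of x "- y"] uminus_mem by simp

lemma power_mem: "x \<in> T \<Longrightarrow> x ^ n \<in> T"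
  by (induction n) (auto simp: one_mem mult_mem)

lemma sum_mem: "(\<And>i. i \<in> A \<Longrightarrow> f i \<in> T) \<Longrightarrow> sum f A \<in> T"
  by (induction A rule: infinite_finite_induct) (auto simp: zero_mem add_mem)

lemma prod_mem: "(\<And>i. i \<in> A \<Longrightarrow> f i \<in> T) \<Longrightarrow> prod f A \<in> T"
  by (induction A rule: infinite_finite_induct) (auto simp: one_mem mult_mem)

lemma of_nat_mem: "of_nat n \<in> T"
  by (induction n) (auto simp: zero_mem one_mem add_mem)

lemma of_int_mem: "of_int n \<in> T"
  by (cases n) (auto simp: of_nat_mem intro: uminus_mem simp del: of_nat_Suc)

lemmas closed = zero_mem one_mem uminus_mem diff_mem add_mem mult_mem power_mem sum_mem prod_mem
  of_nat_mem of_int_mem t_mem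

lemma coeff_prod_mem:
  fixes P :: "'i \<Rightarrow> 'a poly"
  assumes "\<And>i k. i \<in> A \<Longrightarrow> coeff (P i) k \<in> T"
  shows "coeff (\<Prod>i\<in>A. P i) k \<in> T"
  using assms
  by (induction A arbitrary: k rule: infinite_finite_induct) (auto simp: coeff_mult closed)

text \<open>Only differences of nodes occur as denominators. If these are units, the inverse
  Vandermonde matrix has its entries in \<open>T\<close>.\<close>

lemma coeff_lagrange_poly_mem:
  assumes "\<And>i. i \<in> A \<Longrightarrow> z i \<in> T"
    and "\<And>i j. i \<in> A \<Longrightarrow> j \<in> A \<Longrightarrow> i \<noteq> j \<Longrightarrow> 1 / (z i - z j) \<in> T" and "i \<in> A"
  shows "coeff (lagrange_poly z A i) k \<in> T"
proof -
  have "- z j / (z i - z j) \<in> T" "1 / (z i - z j) \<in> T" if "j \<in> A - {i}" for j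
    using that assms uminus_mem mult_mem[of "- z j" "1 / (z i - z j)"] by auto
  then show ?thesis
    unfolding lagrange_poly_def
    by (intro coeff_prod_mem) (auto simp: coeff_pCons zero_mem split: nat.split)
qed

text \<open>This is the ideal generated by \<open>t ^ n\<close>, that is, the n-th step of the
  valuation filtration.\<close>

definition P :: "nat \<Rightarrow> 'a set" where
  "P n = {x. x / t ^ n \<in> T}"

lemma P_0: "P 0 = T"
  by (simp add: P_def)

lemma P_I: "x \<in> T \<Longrightarrow> t ^ n * x \<in> P n"
  using t_nonzero by (simp add: P_def)

lemma P_E:
  assumes "x \<in> P n"
  obtains y where "y \<in> T" and "x = t ^ n * y"
  using assms t_nonzero by (auto simp: P_def intro!: that[of "x / t ^ n"])

lemma P_diff: "x \<in> P n \<Longrightarrow> y \<in> P n \<Longrightarrow> x - y \<in> P n"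
  by (simp add: P_def diff_divide_distrib closed)

lemma P_add: "x \<in> P n \<Longrightarrow> y \<in> P n \<Longrightarrow> x + y \<in> P n"
  by (simp add: P_def add_divide_distrib closed)

lemma P_mult: "x \<in> P m \<Longrightarrow> y \<in> P n \<Longrightarrow> x * y \<in> P (m + n)"
  using mult_mem[of "x / t ^ m" "y / t ^ n"] by (simp add: P_def power_add)

lemma P_zero: "0 \<in> P n"
  by (simp add: P_def zero_mem)

lemma P_mono: "m \<le> n \<Longrightarrow> P n \<subseteq> P m"
proof
  fix x assume "m \<le> n" and "x \<in> P n"
  then have "x / t ^ m = t ^ (n - m) * (x / t ^ n)"
    using t_nonzero by (simp add: power_diff)
  with \<open>x \<in> P n\<close> show "x \<in> P m"
    by (simp add: P_def closed del: times_divide_eq_right)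
qed

lemma mem_P_imp_mem: "x \<in> P n \<Longrightarrow> x \<in> T"
  using P_mono[of 0 n] P_0 by auto

lemma mult_P_iff: "t ^ m * x \<in> P (m + n) \<longleftrightarrow> x \<in> P n"
  using t_nonzero by (simp add: P_def power_add)

text \<open>Take the first power of \<open>t\<close> that does not divide \<open>x\<close>. The
  quotient by the preceding power lies in \<open>T\<close> and is not divisible by \<open>t\<close>,
  hence is a unit.\<close>

lemma unit_decomposition:
  assumes "x \<in> T" and "x \<noteq> 0"
  obtains n u where "u \<in> T" and "1 / u \<in> T" and "x = t ^ n * u"
proof -
  define N where "N = (LEAST n. x / t ^ n \<notin> T)"
  have N: "x / t ^ N \<notin> T"
    unfolding N_def using separated[OF assms(2)] by (rule LeastI_ex)
  have "N \<noteq> 0" using N assms by (intro notI) simp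
  then obtain n where n: "N = Suc n" using not0_implies_Suc by blast
  have "x / t ^ n \<in> T"
    using not_less_Least[of n "\<lambda>n. x / t ^ n \<notin> T"] n N_def by auto
  moreover have "x / t ^ n / t \<notin> T"
    using N n by (simp add: mult.commute)
  ultimately show thesis
    using inverse_mem[of "x / t ^ n"] t_nonzero by (intro that[of "x / t ^ n" n]) auto
qed

text \<open>Numerator and denominator are powers of \<open>t\<close> times units. Outside
  \<open>T\<close> the denominator carries the larger power, so a factor \<open>t\<close> is left in
  the reciprocal.\<close>

lemma inverse_mem_P:
  assumes "x \<notin> T"
  shows "1 / x \<in> P 1"
proof -
  obtain a c where ac: "a \<in> T" "c \<in> T" "x = a / c" using fractions by blast
  then have "a \<noteq> 0" "c \<noteq> 0" using assms zero_mem by auto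
  obtain m u where u: "u \<in> T" "1 / u \<in> T" "a = t ^ m * u"
    using unit_decomposition[OF ac(1) \<open>a \<noteq> 0\<close>] .
  obtain n v where v: "v \<in> T" "1 / v \<in> T" "c = t ^ n * v"
    using unit_decomposition[OF ac(2) \<open>c \<noteq> 0\<close>] .
  show ?thesis
  proof (cases "n \<le> m")
    case True
    then have "x = t ^ (m - n) * (u * (1 / v))"
      using ac u v t_nonzero by (simp add: power_diff)
    also have "\<dots> \<in> T"
      using u v by (intro closed)
    finally show ?thesis using assms by simp
  next
    case False
    then have "1 / x = t ^ (n - m) * (v * (1 / u))"
      using ac u v t_nonzero by (simp add: power_diff)
    also have "\<dots> \<in> P (n - m)"
      using u v by (intro P_I closed)
    also have "\<dots> \<subseteq> P 1"
      using False by (intro P_mono) simp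
    finally show ?thesis .
  qed
qed

text \<open>The powers of an element of negative valuation have no common denominator.\<close>

lemma hom_image_mem:
  assumes hom: "\<And>x y. \<rho> (x * y) = \<rho> x * \<rho> y" "\<rho> 1 = 1"
    and "d \<noteq> 0" and den: "\<And>x. x \<in> T \<Longrightarrow> d * \<rho> x \<in> T" and "x \<in> T"
  shows "\<rho> x \<in> T"
proof (rule ccontr)
  assume nT: "\<rho> x \<notin> T"
  then have nz: "\<rho> x \<noteq> 0" using zero_mem by metis
  from inverse_mem_P[OF nT] have z: "1 / \<rho> x / t \<in> T" by (simp add: P_def)
  have pow: "\<rho> (x ^ n) = \<rho> x ^ n" for n
    by (induction n) (simp_all add: hom)
  \<comment> \<open>The denominator \<open>d\<close> clears \<rho> (x ^ n) for all n at once, while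
    the reciprocal of \<rho> x is divisible by \<open>t\<close>; their product shows that t ^ n
    divides \<open>d\<close>.\<close>
  have "d / t ^ n \<in> T" for n
  proof -
    have "d / t ^ n = d * \<rho> (x ^ n) * (1 / \<rho> x / t) ^ n"
      using nz by (simp add: pow power_divide power_mult_distrib)
    also have "\<dots> \<in> T" using z \<open>x \<in> T\<close> by (intro mult_mem[OF den] power_mem)
    finally show ?thesis .
  qed
  with separated[OF \<open>d \<noteq> 0\<close>] show False by blast
qed

end

section \<open>Discrete valuation rings\<close>

lemma subring_rec_simps [simp]:
  "carrier (subring_rec R) = R" "x \<otimes>\<^bsub>subring_rec R\<^esub> y = x * y" "\<one>\<^bsub>subring_rec R\<^esub> = 1"
  "x \<oplus>\<^bsub>subring_rec R\<^esub> y = x + y" "\<zero>\<^bsub>subring_rec R\<^esub> = 0"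
  by (simp_all add: subring_rec_def ring_of_type_algebra_def)

lemma subring_rec_closed:
  assumes "ring (subring_rec R)"
  shows "0 \<in> R" and "1 \<in> R" and "x \<in> R \<Longrightarrow> y \<in> R \<Longrightarrow> x - y \<in> R"
    and "x \<in> R \<Longrightarrow> y \<in> R \<Longrightarrow> x * y \<in> R"
proof -
  interpret ring "subring_rec R" by fact
  show "0 \<in> R" "1 \<in> R" "x \<in> R \<Longrightarrow> y \<in> R \<Longrightarrow> x * y \<in> R"
    using zero_closed one_closed m_closed[of x y] by simp_all
  show "x - y \<in> R" if "x \<in> R" "y \<in> R"
  proof -
    from r_neg[of y] a_inv_closed[of y] that have "y + (\<ominus>\<^bsub>subring_rec R\<^esub> y) = 0" "\<ominus>\<^bsub>subring_rec R\<^esub> y \<in> R"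
      by simp_all
    then have "- y \<in> R" by (metis add_eq_0_iff)
    with a_closed[of x "- y"] that show ?thesis by simp
  qed
qed

text \<open>The nonzero prime ideal is generated by a prime, hence irreducible, element, so it is
  maximal in the principal domain. Conversely a maximal ideal is prime, and it is nonzero: otherwise
  the ring would be a field and have no nonzero proper ideal. This makes the description operator in
  \<open>max_ideal\<close> meaningful.\<close>

lemma dvr_max_ideal:
  assumes "dvr R"
  shows "maximalideal (max_ideal R) (subring_rec R)" and "max_ideal R \<noteq> {0}"
    and "maximalideal I (subring_rec R) \<Longrightarrow> I = max_ideal R"
proof -
  interpret principal_domain "subring_rec R"
    using assms by (simp add: dvr_def)
  obtain M where M: "primeideal M (subring_rec R)" "M \<noteq> {0}"
    and uniq: "\<And>I. primeideal I (subring_rec R) \<Longrightarrow> I \<noteq> {0} \<Longrightarrow> I = M"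
    using assms unfolding dvr_def by metis
  interpret M: primeideal M "subring_rec R" by fact
  obtain g where g: "g \<in> R" "M = PIdl\<^bsub>subring_rec R\<^esub> g"
    using exists_gen[OF M.is_ideal] by auto
  have "g \<noteq> 0"
    using g M(2) M.zero_closed by (auto simp: cgenideal_def)
  then have "ring_prime\<^bsub>subring_rec R\<^esub> g"
    using g M(1) primeideal_iff_prime[of g] by simp
  then have max: "maximalideal M (subring_rec R)"
    using g primeness_condition irreducible_imp_maximalideal by auto
  have max_eq: "I = M" if "maximalideal I (subring_rec R)" for I
  proof (rule uniq[OF maximalideal_prime[OF that]])
    show "I \<noteq> {0}"
    proof
      assume "I = {0}"
      with that have "field (subring_rec R)"
        by (intro zeromaximalideal_fieldI) simp
      from field.all_ideals[OF this] M.is_ideal M(2) M.I_notcarr show False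
        by auto
    qed
  qed
  have eq: "max_ideal R = M"
    unfolding max_ideal_def using max max_eq by (rule the_equality)
  show "maximalideal (max_ideal R) (subring_rec R)" and "max_ideal R \<noteq> {0}"
    unfolding eq by fact+
  show "I = max_ideal R" if "maximalideal I (subring_rec R)"
    unfolding eq using that by (rule max_eq)
qed

lemma max_ideal_uniformizer:
  assumes "uniformizer R r"
  shows "max_ideal R = {x * r | x. x \<in> R}"
  using assms by (simp add: uniformizer_def cgenideal_def)

text \<open>A nonzero nonunit has an irreducible divisor. This divisor generates a maximal ideal,
  which can only be \<open>max_ideal R\<close>, and so the nonunit lies there.\<close>

lemma dvr_inverse_mem:
  assumes "dvr R" and "x \<in> R" and "x \<notin> max_ideal R"
  shows "1 / x \<in> R"
proof -
  interpret principal_domain "subring_rec R"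
    using assms by (simp add: dvr_def)
  interpret M: maximalideal "max_ideal R" "subring_rec R"
    using assms by (intro dvr_max_ideal)
  have "x \<noteq> 0" using assms M.zero_closed by auto
  have "x \<in> Units (subring_rec R)"
  proof (rule ccontr)
    assume "x \<notin> Units (subring_rec R)"
    moreover have "x \<in> carrier (subring_rec R) - {\<zero>\<^bsub>subring_rec R\<^esub>}"
      using assms \<open>x \<noteq> 0\<close> by simp
    ultimately obtain q where q: "q \<in> R" "ring_irreducible\<^bsub>subring_rec R\<^esub> q"
      "q divides\<^bsub>subring_rec R\<^esub> x"
      using exists_irreducible_divisor[of x] by (metis subring_rec_simps(1))
    have "PIdl\<^bsub>subring_rec R\<^esub> q = max_ideal R"
      using irreducible_imp_maximalideal[of q] q dvr_max_ideal(3)[OF assms(1)] by simp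
    moreover have "x \<in> PIdl\<^bsub>subring_rec R\<^esub> q"
      using q(3) by (auto simp: factor_def cgenideal_def mult.commute)
    ultimately show False using assms by simp
  qed
  then obtain y where "y \<in> R" "x * y = 1"
    by (auto simp: Units_def)
  with \<open>x \<noteq> 0\<close> show ?thesis
    by (metis nonzero_mult_div_cancel_left)
qed

text \<open>Krull's intersection theorem for a principal domain: a generator of the ideal of all
  \<open>x\<close> with some \<open>x * r ^ n\<close> divisible by \<open>d\<close> would make \<open>r\<close> a unit.\<close>

lemma principal_domain_separated:
  assumes "principal_domain (subring_rec R)" and "r \<in> R" and "r \<noteq> 0" and "1 / r \<notin> R"
    and "d \<noteq> 0"
  shows "\<exists>n. d / r ^ n \<notin> R"
proof (rule ccontr)
  assume "\<not> ?thesis"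
  then have div: "d / r ^ n \<in> R" for n by simp
  interpret principal_domain "subring_rec R" by fact
  note cl = subring_rec_closed[OF ring_axioms]
  have pow: "r ^ n \<in> R" for n
    by (induction n) (auto simp: cl assms)
  \<comment> \<open>\<open>J\<close> is the union of the increasing chain of ideals generated by the
    quotients \<open>d / r ^ n\<close>.\<close>
  define J where "J = {x \<in> R. \<exists>n. x * r ^ n / d \<in> R}"
  have "ideal J (subring_rec R)"
  proof (rule idealI[OF ring_axioms])
    have J_diff: "x - y \<in> J" if xy: "x \<in> J" "y \<in> J" for x y
    proof -
      obtain m n where "x * r ^ m / d \<in> R" "y * r ^ n / d \<in> R"
        using xy by (auto simp: J_def)
      then have "(x * r ^ m / d) * r ^ n - (y * r ^ n / d) * r ^ m \<in> R"
        using pow by (intro cl)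
      also have "(x * r ^ m / d) * r ^ n - (y * r ^ n / d) * r ^ m = (x - y) * r ^ (m + n) / d"
        by (simp add: power_add algebra_simps diff_divide_distrib)
      finally show ?thesis using xy cl by (auto simp: J_def)
    qed
    have J0: "0 \<in> J" by (auto simp: J_def cl)
    show "subgroup J (add_monoid (subring_rec R))"
    proof (rule add.subgroupI)
      show "J \<subseteq> carrier (subring_rec R)" by (auto simp: J_def)
      show "J \<noteq> {}" using J0 by auto
      have neg: "\<ominus>\<^bsub>subring_rec R\<^esub> y = - y" if "y \<in> R" for y
      proof (rule minus_equality)
        show "- y \<in> carrier (subring_rec R)" using cl(3)[OF cl(1) that] by simp
      qed (use that in auto)
      show "\<ominus>\<^bsub>subring_rec R\<^esub> y \<in> J" if "y \<in> J" for y
        using J_diff[OF J0 that] neg[of y] that by (simp add: J_def)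
      show "x \<oplus>\<^bsub>subring_rec R\<^esub> y \<in> J" if "x \<in> J" "y \<in> J" for x y
        using J_diff[OF \<open>x \<in> J\<close> J_diff[OF J0 \<open>y \<in> J\<close>]] by simp
    qed
    have J_mult: "x * y \<in> J" if x: "x \<in> J" and y: "y \<in> R" for x y
    proof -
      obtain m where "x * r ^ m / d \<in> R" using x by (auto simp: J_def)
      then have "(x * r ^ m / d) * y \<in> R" using y by (intro cl)
      then have "x * y * r ^ m / d \<in> R" by (simp add: mult.assoc mult.commute[of y])
      with x y show ?thesis by (auto simp: J_def cl)
    qed
    show "x \<otimes>\<^bsub>subring_rec R\<^esub> a \<in> J" "a \<otimes>\<^bsub>subring_rec R\<^esub> x \<in> J"
      if "a \<in> J" "x \<in> carrier (subring_rec R)" for a x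
      using J_mult[of a x] that by (simp_all add: mult.commute)
  qed
  then obtain g where g: "g \<in> R" "J = {x * g | x. x \<in> R}"
    using exists_gen by (force simp: cgenideal_def)
  have "1 * g \<in> J" using g cl by blast
  then obtain n where "g * r ^ n / d \<in> R" by (auto simp: J_def)
  moreover define h where "h = g * r ^ n / d"
  ultimately have h: "h \<in> R" "g * r ^ n = d * h" using \<open>d \<noteq> 0\<close> by simp_all
  \<comment> \<open>The generator \<open>g\<close> already lies in the ideal of
    \<open>d / r ^ n\<close>, and the next quotient of the chain is still a multiple of
    \<open>g\<close>. Cancelling \<open>d\<close> then exhibits an inverse of
    \<open>r\<close>.\<close>
  have "d / r ^ Suc n \<in> J"
    unfolding J_def using div \<open>r \<noteq> 0\<close> \<open>d \<noteq> 0\<close> cl by (auto intro!: exI[of _ "Suc n"] simp del: power_Suc)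
  then obtain k where k: "k \<in> R" "d / r ^ Suc n = k * g" using g by auto
  have "d = r * (k * (g * r ^ n))"
    using k(2) \<open>r \<noteq> 0\<close> by (simp add: field_simps)
  then have "d * 1 = d * (r * (h * k))" by (simp add: h ac_simps)
  then have "1 / r = h * k"
    using \<open>r \<noteq> 0\<close> \<open>d \<noteq> 0\<close> by (simp only: mult_cancel_left) (simp add: field_simps)
  with h k cl assms show False by auto
qed

lemma dvr_valuation_ring:
  assumes "dvr T" and "uniformizer T t" and "fraction_field T = UNIV"
  shows "valuation_ring T t"
proof
  interpret principal_domain "subring_rec T"
    using assms by (simp add: dvr_def)
  interpret M: maximalideal "max_ideal T" "subring_rec T"
    using assms by (intro dvr_max_ideal)
  note cl = subring_rec_closed[OF ring_axioms]
  note max = max_ideal_uniformizer[OF assms(2)]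
  show "x - y \<in> T" "x * y \<in> T" if "x \<in> T" "y \<in> T" for x y
    using that cl by auto
  show "1 \<in> T" by (rule cl)
  show "t \<in> T" using assms by (simp add: uniformizer_def)
  show "t \<noteq> 0"
    using dvr_max_ideal(2)[OF assms(1)] max cl by auto
  show nonunit: "1 / t \<notin> T"
  proof
    assume *: "1 / t \<in> T"
    have "x \<in> max_ideal T" if "x \<in> T" for x
      using cl(4)[OF that *] \<open>t \<noteq> 0\<close> by (auto simp: max intro!: exI[of _ "x / t"])
    with M.I_notcarr M.a_subset show False by auto
  qed
  show "1 / x \<in> T" if "x \<in> T" "x / t \<notin> T" for x
  proof (rule dvr_inverse_mem[OF assms(1) \<open>x \<in> T\<close>])
    show "x \<notin> max_ideal T" using \<open>t \<noteq> 0\<close> that(2) by (auto simp: max)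
  qed
  show "\<exists>n. x / t ^ n \<notin> T" if "x \<noteq> 0" for x
    using principal_domain_separated[OF principal_domain_axioms \<open>t \<in> T\<close> \<open>t \<noteq> 0\<close> nonunit that] .
  show "\<exists>a\<in>T. \<exists>b\<in>T. x = a / b" for x
  proof -
    have "x \<in> fraction_field T" using assms by simp
    then show ?thesis by (auto simp: fraction_field_def)
  qed
qed

lemma (in valuation_ring) max_ideal_eq_P:
  assumes "uniformizer T t"
  shows "max_ideal T = P 1"
  using t_nonzero by (auto simp: max_ideal_uniformizer[OF assms] P_def intro!: exI[of _ "_ / t"])

text \<open>If no exponent exceeded \<open>n\<close>, the supremum would be at most
  \<open>n\<close>; so some exponent is at least \<open>Suc n\<close>, and the ideals decrease. The
  value 0 is excluded because it is also the supremum of the empty set, which occurs for elements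
  outside \<open>T\<close>.\<close>

lemma (in valuation_ring) val_eq_SucD:
  assumes "val T t x = enat (Suc n)"
  shows "x \<in> P (Suc n)" and "x \<notin> P (Suc (Suc n))"
proof -
  have set: "{n. \<exists>y\<in>T. x = t ^ n * y} = {n. x \<in> P n}"
    using P_I by (auto elim!: P_E)
  have le: "m \<le> Suc n" if "x \<in> P m" for m
  proof -
    have "enat m \<le> val T t x" unfolding val_def set using that by (intro SUP_upper) auto
    then show ?thesis using assms by simp
  qed
  then show "x \<notin> P (Suc (Suc n))" by fastforce
  have "\<exists>m. x \<in> P m \<and> n < m"
  proof (rule ccontr)
    assume "\<not> ?thesis"
    then have "val T t x \<le> enat n"
      unfolding val_def set by (intro SUP_least) (auto simp: not_less)
    then show False using assms by simp
  qed
  then obtain m where "x \<in> P m" "Suc n \<le> m" by auto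
  then show "x \<in> P (Suc n)" using P_mono by blast
qed

section \<open>The Galois group\<close>

lemma galois_group_simps [simp]:
  "x \<otimes>\<^bsub>galois_group K\<^esub> y = y \<circ> x" "\<one>\<^bsub>galois_group K\<^esub> = id"
  by (simp_all add: galois_group_def)

lemma mem_galois_group:
  "\<rho> \<in> carrier (galois_group K) \<longleftrightarrow> bij \<rho> \<and> (\<forall>x y. \<rho> (x + y) = \<rho> x + \<rho> y) \<and>
     (\<forall>x y. \<rho> (x * y) = \<rho> x * \<rho> y) \<and> \<rho> 1 = 1 \<and> (\<forall>x\<in>K. \<rho> x = x)"
  by (auto simp: galois_group_def ring_iso_def ring_hom_def ring_of_type_algebra_def)

lemma group_galois_group: "group (galois_group K)"
proof (rule groupI)
  fix \<rho> assume \<rho>: "\<rho> \<in> carrier (galois_group K)"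
  then have "bij \<rho>" by (simp add: mem_galois_group)
  then have inv: "inv_into UNIV \<rho> (\<rho> x) = x" "\<rho> (inv_into UNIV \<rho> x) = x" for x
    by (simp_all add: bij_is_inj bij_is_surj surj_f_inv_f)
  show "\<exists>\<tau>\<in>carrier (galois_group K). \<tau> \<otimes>\<^bsub>galois_group K\<^esub> \<rho> = \<one>\<^bsub>galois_group K\<^esub>"
  proof (rule bexI[of _ "inv_into UNIV \<rho>"])
    show "inv_into UNIV \<rho> \<in> carrier (galois_group K)"
      unfolding mem_galois_group
    proof (intro conjI allI ballI)
      show "bij (inv_into UNIV \<rho>)" using \<open>bij \<rho>\<close> by (rule bij_imp_bij_inv)
      show "inv_into UNIV \<rho> (x + y) = inv_into UNIV \<rho> x + inv_into UNIV \<rho> y" for x y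
        using \<rho> inv unfolding mem_galois_group by metis
      show "inv_into UNIV \<rho> (x * y) = inv_into UNIV \<rho> x * inv_into UNIV \<rho> y" for x y
        using \<rho> inv unfolding mem_galois_group by metis
      show "inv_into UNIV \<rho> 1 = 1" 
        using \<rho> inv unfolding mem_galois_group by metis
      show "inv_into UNIV \<rho> x = x" if "x \<in> K" for x
        using \<rho> inv that unfolding mem_galois_group by metis
    qed
    show "inv_into UNIV \<rho> \<otimes>\<^bsub>galois_group K\<^esub> \<rho> = \<one>\<^bsub>galois_group K\<^esub>"
      using inv by (simp add: fun_eq_iff)
  qed
next
  show "\<rho> \<otimes>\<^bsub>galois_group K\<^esub> \<tau> \<in> carrier (galois_group K)"
    if "\<rho> \<in> carrier (galois_group K)" "\<tau> \<in> carrier (galois_group K)" for \<rho> \<tau>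
    using that bij_comp[of \<rho> \<tau>] by (simp add: mem_galois_group)
  show "\<one>\<^bsub>galois_group K\<^esub> \<in> carrier (galois_group K)"
    by (simp add: mem_galois_group)
  show "\<rho> \<otimes>\<^bsub>galois_group K\<^esub> \<tau> \<otimes>\<^bsub>galois_group K\<^esub> \<upsilon> = \<rho> \<otimes>\<^bsub>galois_group K\<^esub> (\<tau> \<otimes>\<^bsub>galois_group K\<^esub> \<upsilon>)" for \<rho> \<tau> \<upsilon>
    by (simp add: fun_eq_iff)
  show "\<one>\<^bsub>galois_group K\<^esub> \<otimes>\<^bsub>galois_group K\<^esub> \<rho> = \<rho>" for \<rho>
    by (simp add: fun_eq_iff)
qed

lemma galois_group_pow: "\<sigma> [^]\<^bsub>galois_group K\<^esub> (n::nat) = \<sigma> ^^ n"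
  by (induction n) simp_all

section \<open>Wildly ramified cyclic extensions\<close>

text \<open>The conditions on residue fields and valuations are expressed through the filtration
  \<open>P\<close>: \<open>P 1\<close> is the maximal ideal of \<open>T\<close>, and
  \<open>ramification\<close> says that the valuation of \<open>\<sigma> t - t\<close> is exactly b
  + 1.\<close>

locale wild_extension = valuation_ring T t for T :: "'a::field set" and t :: 'a +
  fixes S :: "'a set" and \<sigma> :: "'a \<Rightarrow> 'a" and p b :: nat
  assumes base_cring: "cring (subring_rec S)" and base_subset: "S \<subseteq> T"
    and base_finite: "finite_over S T"
    and fixed_field: "{x. \<forall>\<rho>\<in>carrier (galois_group (fraction_field S)). \<rho> x = x} = fraction_field S"
    and cyclic: "carrier (galois_group (fraction_field S)) = range (\<lambda>k. \<sigma> ^^ k)"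
    and order_galois: "Coset.order (galois_group (fraction_field S)) = p" and p_pos: "p > 0"
    and residue_trivial: "x \<in> T \<Longrightarrow> \<exists>y\<in>S. x - y \<in> P 1"
    and residue_char_p: "of_nat n \<in> P 1 \<longleftrightarrow> p dvd n"
    and ramification: "\<sigma> t - t \<in> P (Suc b)" "\<sigma> t - t \<notin> P (Suc (Suc b))" and wild: "b \<ge> 1"
begin

abbreviation "K \<equiv> fraction_field S"
abbreviation "G \<equiv> galois_group K"

lemma base_ring: "ring (subring_rec S)"
  using base_cring by (rule cring.axioms)

lemmas base_closed = subring_rec_closed[OF base_ring]

lemma finite_G: "finite (carrier G)" and card_G: "card (carrier G) = p"
  using order_galois p_pos by (auto simp: Coset.order_def card_gt_0_iff)

lemma id_mem: "id \<in> carrier G"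
  using group.is_monoid[OF group_galois_group, THEN monoid.one_closed] by simp

lemma comp_mem: "\<rho> \<in> carrier G \<Longrightarrow> \<tau> \<in> carrier G \<Longrightarrow> \<tau> \<circ> \<rho> \<in> carrier G"
  using group.is_monoid[OF group_galois_group, THEN monoid.m_closed, of \<rho> K \<tau>] by simp

lemma inverse_in_G:
  assumes "\<rho> \<in> carrier G"
  obtains \<rho>' where "\<rho>' \<in> carrier G" and "\<rho> \<circ> \<rho>' = id" and "\<rho>' \<circ> \<rho> = id"
  using group.inv_closed[OF group_galois_group assms]
    group.l_inv[OF group_galois_group assms] group.r_inv[OF group_galois_group assms]
  by (auto intro: that)

section \<open>Galois automorphisms and their action on the valuation ring\<close>

context
  fixes \<rho> assumes \<rho>: "\<rho> \<in> carrier G"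
begin

lemma G_add: "\<rho> (x + y) = \<rho> x + \<rho> y" and G_mult: "\<rho> (x * y) = \<rho> x * \<rho> y" and G_one: "\<rho> 1 = 1"
  and G_bij: "bij \<rho>" and G_fix_K: "x \<in> K \<Longrightarrow> \<rho> x = x"
  using \<rho> by (auto simp: mem_galois_group)

lemma G_zero: "\<rho> 0 = 0"
  using G_add[of 0 0] by (metis add_0 add_cancel_right_right)

lemma G_diff: "\<rho> (x - y) = \<rho> x - \<rho> y"
  using G_add[of "x - y" y] by simp

lemma G_power: "\<rho> (x ^ n) = \<rho> x ^ n"
  by (induction n) (simp_all add: G_one G_mult)

lemma G_sum: "\<rho> (sum f A) = (\<Sum>i\<in>A. \<rho> (f i))"
  by (induction A rule: infinite_finite_induct) (simp_all add: G_zero G_add)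

lemma G_fix_S: "x \<in> S \<Longrightarrow> \<rho> x = x"
  using base_closed(2) by (intro G_fix_K) (force simp: fraction_field_def)

lemma G_eq_0_iff: "\<rho> x = 0 \<longleftrightarrow> x = 0"
  using bij_is_inj[OF G_bij] G_zero by (metis injD)

lemma G_divide: "\<rho> (x / y) = \<rho> x / \<rho> y"
  using G_mult[of "x / y" y] G_zero by (cases "y = 0") (auto simp: G_eq_0_iff G_zero field_simps)

text \<open>Since \<open>S\<close> is fixed and \<open>T\<close> is finite over \<open>S\<close>, a
  common denominator for the images of the finitely many generators is one for the whole image of
  \<open>T\<close>. Then \<open>hom_image_mem\<close> applies.\<close>

lemma G_mem:
  assumes "x \<in> T"
  shows "\<rho> x \<in> T"
proof -
  obtain B where B: "finite B" "B \<subseteq> T"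
    and span: "\<And>x. x \<in> T \<Longrightarrow> \<exists>c\<in>B \<rightarrow> S. x = (\<Sum>b\<in>B. c b * b)"
    using base_finite unfolding finite_over_def by blast
  have "\<exists>v. v \<in> T \<and> v \<noteq> 0 \<and> v * \<rho> y \<in> T" for y
  proof -
    obtain u v where uv: "u \<in> T" "v \<in> T" "\<rho> y = u / v" using fractions by blast
    show ?thesis
    proof (cases "v = 0")
      \<comment> \<open>Division by zero yields 0, so \<open>\<rho> y\<close> vanishes and 1 serves
        as its denominator.\<close>
      case True
      then show ?thesis using uv one_mem zero_mem by (intro exI[of _ 1]) auto
    next
      case False
      then show ?thesis using uv by (intro exI[of _ v]) auto
    qed
  qed
  then obtain v where v: "\<And>y. v y \<in> T" "\<And>y. v y \<noteq> 0" "\<And>y. v y * \<rho> y \<in> T" by metis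
  define d where "d = prod v B"
  have "d * \<rho> y \<in> T" if y: "y \<in> T" for y
  proof -
    obtain c where c: "c \<in> B \<rightarrow> S" "y = (\<Sum>b\<in>B. c b * b)" using span[OF y] by blast
    have "\<rho> y = (\<Sum>b\<in>B. c b * \<rho> b)"
      unfolding c(2) G_sum
      by (intro sum.cong refl) (simp add: G_mult G_fix_S[OF funcset_mem[OF c(1)]])
    then have "d * \<rho> y = (\<Sum>b\<in>B. c b * (d * \<rho> b))"
      by (simp add: sum_distrib_left mult.left_commute)
    also have "\<dots> \<in> T"
    proof (rule sum_mem, rule mult_mem)
      fix b assume b: "b \<in> B"
      then show "c b \<in> T" using c(1) base_subset by auto
      have "d * \<rho> b = prod v (B - {b}) * (v b * \<rho> b)"
        unfolding d_def using b B(1) by (simp add: prod.remove mult.commute mult.left_commute)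
      also have "\<dots> \<in> T" using v by (intro mult_mem[OF prod_mem])
      finally show "d * \<rho> b \<in> T" .
    qed
    finally show ?thesis .
  qed
  moreover have "d \<noteq> 0" using B(1) v(2) by (simp add: d_def)
  ultimately show ?thesis
    using assms hom_image_mem[of \<rho> d x] G_mult G_one by blast
qed

end

section \<open>The Galois action on the valuation filtration, and the ramification break\<close>

lemma P_power: "x \<in> P 1 \<Longrightarrow> x ^ n \<in> P n"
  using P_mult[of x 1] by (induction n) (auto simp: P_0 one_mem)

text \<open>Otherwise \<open>\<rho> t\<close> would be a unit, and the inverse automorphism would
  carry its reciprocal to 1 / t in \<open>T\<close>.\<close>

lemma G_uniformizer:
  assumes "\<rho> \<in> carrier G"
  shows "\<rho> t \<in> P 1"
proof (rule ccontr)
  obtain \<rho>' where \<rho>': "\<rho>' \<in> carrier G" "\<rho>' \<circ> \<rho> = id"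
    using inverse_in_G[OF assms] by blast
  assume "\<rho> t \<notin> P 1"
  then have "1 / \<rho> t \<in> T"
    using inverse_mem[of "\<rho> t"] G_mem[OF assms t_mem] by (simp add: P_def)
  then have "\<rho>' (1 / \<rho> t) \<in> T" by (rule G_mem[OF \<rho>'(1)])
  also have "\<rho>' (1 / \<rho> t) = 1 / t"
    using \<rho>' G_divide[OF \<rho>'(1)] G_one[OF \<rho>'(1)] by (simp add: pointfree_idE)
  finally show False using t_nonunit by simp
qed

lemma G_P:
  assumes "\<rho> \<in> carrier G" and "x \<in> P n"
  shows "\<rho> x \<in> P n"
proof -
  obtain y where y: "y \<in> T" "x = t ^ n * y" using P_E[OF assms(2)] .
  have "\<rho> t ^ n * \<rho> y \<in> P (n + 0)"
    using assms y by (intro P_mult P_power G_uniformizer) (simp_all add: P_0 G_mem[OF assms(1)])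
  then show ?thesis
    using y by (simp add: G_mult[OF assms(1)] G_power[OF assms(1)])
qed

lemma pow_G: "\<sigma> ^^ m \<in> carrier G"
  using cyclic by auto

lemma sigma_G: "\<sigma> \<in> carrier G"
  using pow_G[of 1] by simp

text \<open>The difference for m + 1 is the \<sigma>-image of the difference for m plus
  \<open>\<sigma> t - t\<close>.\<close>

lemma pow_ramification: "(\<sigma> ^^ m) t - t \<in> P (Suc b)"
proof (induction m)
  case 0
  then show ?case by (simp add: P_zero)
next
  case (Suc m)
  have "\<sigma> ((\<sigma> ^^ m) t - t) + (\<sigma> t - t) \<in> P (Suc b)"
    by (rule P_add[OF G_P[OF sigma_G Suc] ramification(1)])
  then show ?case by (simp add: G_diff[OF sigma_G])
qed

lemma G_ramification: "\<rho> \<in> carrier G \<Longrightarrow> \<rho> t - t \<in> P (Suc b)"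
  using pow_ramification cyclic by auto

text \<open>The group acts trivially on the graded pieces of the filtration. In degree 0, residue
  classes have representatives in \<open>S\<close>, which are fixed. For x = t w, the difference
  \<rho> x - x is \<rho> t (\<rho> w - w) + (\<rho> t - t) w; the second term gains enough valuation
  because b \<ge> 1 puts \<open>\<rho> t - t\<close> into \<open>P 2\<close>.\<close>

lemma G_P_diff:
  assumes "\<rho> \<in> carrier G" and "x \<in> P n"
  shows "\<rho> x - x \<in> P (Suc n)"
  using assms(2)
proof (induction n arbitrary: x)
  case 0
  then have "x \<in> T" by (simp add: P_0)
  then obtain y where y: "y \<in> S" "x - y \<in> P 1" using residue_trivial by blast
  have "\<rho> (x - y) - (x - y) \<in> P 1" by (rule P_diff[OF G_P[OF assms(1) y(2)] y(2)])
  then show ?case using y by (simp add: G_diff[OF assms(1)] G_fix_S[OF assms(1)])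
next
  case (Suc n)
  obtain z where z: "z \<in> T" "x = t ^ Suc n * z" using P_E[OF Suc.prems] .
  define w where "w = t ^ n * z"
  have w: "w \<in> P n" "x = t * w" using z P_I[OF z(1)] by (simp_all add: w_def)
  have "\<rho> t - t \<in> P 2"
    using G_ramification[OF assms(1)] P_mono[of 2 "Suc b"] wild by auto
  then have "(\<rho> t - t) * w \<in> P (2 + n)" using w(1) by (rule P_mult)
  moreover have "\<rho> t * (\<rho> w - w) \<in> P (1 + Suc n)"
    by (rule P_mult[OF G_uniformizer[OF assms(1)] Suc.IH[OF w(1)]])
  ultimately have "\<rho> t * (\<rho> w - w) + (\<rho> t - t) * w \<in> P (Suc (Suc n))"
    by (intro P_add) simp_all
  then show ?case using w by (simp add: G_mult[OF assms(1)] algebra_simps)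
qed

text \<open>By \<open>G_P_diff\<close>, applying \<sigma> to an element of \<open>P (Suc b)\<close>
  changes it only within \<open>P (Suc (Suc b))\<close>. So at this precision every further power of
  \<sigma> adds one more copy of \<open>\<sigma> t - t\<close>.\<close>

lemma pow_linear: "(\<sigma> ^^ m) t - t - of_nat m * (\<sigma> t - t) \<in> P (Suc (Suc b))"
proof (induction m)
  case 0
  then show ?case by (simp add: P_zero)
next
  case (Suc m)
  have "\<sigma> ((\<sigma> ^^ m) t - t) - ((\<sigma> ^^ m) t - t) \<in> P (Suc (Suc b))"
    by (rule G_P_diff[OF sigma_G pow_ramification])
  from P_add[OF this Suc]
  show ?case by (simp add: G_diff[OF sigma_G] algebra_simps)
qed

lemma of_int_mem_P:
  assumes "of_int k \<in> P 1"
  shows "int p dvd k"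
proof -
  have "(of_nat (nat \<bar>k\<bar>) :: 'a) = of_int k \<or> (of_nat (nat \<bar>k\<bar>) :: 'a) = 0 - of_int k"
    by (cases "k \<ge> 0") auto
  then have "(of_nat (nat \<bar>k\<bar>) :: 'a) \<in> P 1"
    using assms P_diff[OF P_zero assms] by metis
  then have "p dvd nat \<bar>k\<bar>" by (rule residue_char_p[THEN iffD1])
  then show ?thesis by simp
qed

lemma pow_p: "\<sigma> ^^ p = id"
  using group.pow_order_eq_1[OF group_galois_group sigma_G] order_galois
  by (simp add: galois_group_pow)

text \<open>Let c be the unit (\<sigma> t - t) / t^(b+1). For powers m and n of \<sigma>, the
  difference is (m - n) c t^(b+1) modulo t^(b+2). If it vanished there, m - n would lie in the
  maximal ideal, so p would divide m - n and the two powers would coincide.\<close>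

lemma ramification_distinct:
  assumes "\<rho> \<in> carrier G" and "\<tau> \<in> carrier G" and "\<rho> \<noteq> \<tau>"
  shows "\<rho> t - \<tau> t \<notin> P (Suc (Suc b))"
proof
  assume *: "\<rho> t - \<tau> t \<in> P (Suc (Suc b))"
  obtain m n where mn: "\<rho> = \<sigma> ^^ m" "\<tau> = \<sigma> ^^ n" using assms cyclic by auto
  obtain c where c: "c \<in> T" "\<sigma> t - t = t ^ Suc b * c" using P_E[OF ramification(1)] .
  have "c \<notin> P 1"
    using ramification(2) mult_P_iff[of "Suc b" c 1] by (simp add: c(2))
  then have "1 / c \<in> T"
    using c(1) inverse_mem[of c] by (simp add: P_def)
  have "((\<sigma> ^^ n) t - t - of_nat n * (\<sigma> t - t)) - ((\<sigma> ^^ m) t - t - of_nat m * (\<sigma> t - t)) +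
      (\<rho> t - \<tau> t) \<in> P (Suc (Suc b))"
    by (rule P_add[OF P_diff[OF pow_linear pow_linear] *])
  also have "((\<sigma> ^^ n) t - t - of_nat n * (\<sigma> t - t)) - ((\<sigma> ^^ m) t - t - of_nat m * (\<sigma> t - t)) +
      (\<rho> t - \<tau> t) = t ^ Suc b * (of_int (int m - int n) * c)"
    unfolding mn c(2) by (simp add: algebra_simps)
  finally have "of_int (int m - int n) * c \<in> P 1"
    using mult_P_iff[of "Suc b" "of_int (int m - int n) * c" 1] by simp
  then have "of_int (int m - int n) * c * (1 / c) \<in> P (1 + 0)"
    using \<open>1 / c \<in> T\<close> by (intro P_mult) (simp_all add: P_0)
  moreover have "c \<noteq> 0" using \<open>c \<notin> P 1\<close> P_zero by auto
  ultimately have "int p dvd int m - int n"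
    by (intro of_int_mem_P) simp
  then have "m mod p = n mod p"
    by (metis mod_eq_dvd_iff of_nat_eq_iff of_nat_mod)
  then have "(\<sigma> ^^ m) x = (\<sigma> ^^ n) x" for x
    using funpow_mod_eq[where f = \<sigma> and n = p and m = m and x = x]
      funpow_mod_eq[where f = \<sigma> and n = p and m = n and x = x] by (simp add: pow_p)
  with assms(3) mn show False by (auto simp: fun_eq_iff)
qed

section \<open>Interpolation at the conjugates of the uniformizer and at their normalized
  differences\<close>

lemma inj_on_conjugates: "inj_on (\<lambda>\<rho>. \<rho> t) (carrier G)"
  using ramification_distinct P_zero by (metis (mono_tags, lifting) diff_self inj_onI)

text \<open>These are the coefficients a of the introduction. The sign is that of
  \<open>t - \<rho> t\<close>, whose powers are produced by the iterated commutators.\<close>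

definition slope :: "('a \<Rightarrow> 'a) \<Rightarrow> 'a" where
  "slope \<rho> = (t - \<rho> t) / t ^ Suc b"

lemma slope: "t - \<rho> t = t ^ Suc b * slope \<rho>"
  using t_nonzero by (simp add: slope_def)

lemma slope_mem: "\<rho> \<in> carrier G \<Longrightarrow> slope \<rho> \<in> T"
  using P_diff[OF P_zero G_ramification, of \<rho>] by (simp add: slope_def P_def)

text \<open>The difference of slopes is (\<tau> t - \<rho> t) / t^(b+1), which \<open>t\<close> does
  not divide by \<open>ramification_distinct\<close>; hence it is a unit.\<close>

lemma slope_diff:
  assumes "\<rho> \<in> carrier G" and "\<tau> \<in> carrier G" and "\<rho> \<noteq> \<tau>"
  shows "1 / (slope \<rho> - slope \<tau>) \<in> T"
proof (rule inverse_mem)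
  show "slope \<rho> - slope \<tau> \<in> T" using assms by (intro diff_mem slope_mem)
  have "slope \<rho> - slope \<tau> = (\<tau> t - \<rho> t) / t ^ Suc b"
    by (simp add: slope_def flip: diff_divide_distrib)
  then show "(slope \<rho> - slope \<tau>) / t \<notin> T"
    using ramification_distinct[of \<tau> \<rho>] assms by (simp add: P_def mult.commute)
qed

lemma inj_on_slope: "inj_on slope (carrier G)"
proof (rule inj_onI)
  fix \<rho> \<tau> assume mem: "\<rho> \<in> carrier G" "\<tau> \<in> carrier G" and "slope \<rho> = slope \<tau>"
  then have "t - \<rho> t = t - \<tau> t" by (simp only: slope)
  then have "\<rho> t = \<tau> t" by simp
  then show "\<rho> = \<tau>" using mem by (rule inj_onD[OF inj_on_conjugates])
qed

lemma coeff_lagrange_slope_mem: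
  "\<rho> \<in> carrier G \<Longrightarrow> coeff (lagrange_poly slope (carrier G) \<rho>) k \<in> T"
  by (intro coeff_lagrange_poly_mem slope_mem slope_diff)

text \<open>The polynomial interpolating \<open>\<rho> t \<mapsto> \<rho> x\<close> is Galois invariant and takes the value \<open>x\<close>
  at \<open>t\<close>.\<close>

lemma powers_span:
  obtains c where "\<And>k. c k \<in> K" and "x = (\<Sum>k<p. c k * t ^ k)"
proof -
  have ne: "carrier G \<noteq> {}" using id_mem by auto
  define Q where "Q = (\<Sum>\<rho>\<in>carrier G. smult (\<rho> x) (lagrange_poly (\<lambda>\<rho>. \<rho> t) (carrier G) \<rho>))"
  have deg: "degree Q < p"
    unfolding Q_def using degree_interpolation_less[OF finite_G ne] by (simp add: card_G)
  have Q: "poly Q (\<rho> t) = \<rho> x" if "\<rho> \<in> carrier G" for \<rho>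
    unfolding Q_def using poly_interpolation[OF finite_G inj_on_conjugates that] by simp
  have "map_poly \<tau> Q = Q" if \<tau>: "\<tau> \<in> carrier G" for \<tau>
  proof (rule poly_eqI_interpolation[OF finite_G inj_on_conjugates])
    show "degree (map_poly \<tau> Q) < card (carrier G)"
      using le_less_trans[OF map_poly_degree_leq deg] by (simp add: card_G)
    show "degree Q < card (carrier G)" using deg by (simp add: card_G)
    fix \<rho> assume \<rho>: "\<rho> \<in> carrier G"
    obtain \<tau>' where \<tau>': "\<tau>' \<in> carrier G" "\<tau> \<circ> \<tau>' = id" using inverse_in_G[OF \<tau>] by blast
    have eval: "poly (map_poly \<tau> R) (\<tau> y) = \<tau> (poly R y)" for R y
      by (induction R) (simp_all add: map_poly_pCons G_zero[OF \<tau>] G_add[OF \<tau>] G_mult[OF \<tau>])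
    have inv: "\<tau> (\<tau>' y) = y" for y using \<tau>'(2) by (simp add: pointfree_idE)
    \<comment> \<open>The node \<open>\<rho> t\<close> is the \<tau>-image of the node
      \<open>\<tau>' (\<rho> t)\<close>, where \<open>Q\<close> takes the value
      \<open>\<tau>' (\<rho> x)\<close>; applying \<tau> to this value gives \<open>\<rho> x\<close>
      back.\<close>
    show "poly (map_poly \<tau> Q) (\<rho> t) = poly Q (\<rho> t)"
      using eval[of Q "\<tau>' (\<rho> t)"] Q[OF comp_mem[OF \<rho> \<tau>'(1)]] Q[OF \<rho>] by (simp add: inv)
  qed
  then have "\<tau> (coeff Q k) = coeff Q k" if "\<tau> \<in> carrier G" for k \<tau>
    using that coeff_map_poly[of \<tau> Q k, OF G_zero[OF that]] by simp
  then have "coeff Q k \<in> K" for k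
    using fixed_field by blast
  moreover have "x = (\<Sum>k<p. coeff Q k * t ^ k)"
  proof -
    have "x = poly Q t" using Q[OF id_mem] by simp
    also have "\<dots> = (\<Sum>k<p. coeff Q k * t ^ k)"
      unfolding poly_altdef using deg
      by (intro sum.mono_neutral_left) (auto simp: coeff_eq_0)
    finally show ?thesis .
  qed
  ultimately show thesis by (rule that)
qed

text \<open>The powers of \<open>t\<close> below p span the field over \<open>K\<close>. Clearing
  denominators, a nonzero \<open>S\<close>-multiple of \<open>x\<close> is an
  \<open>S\<close>-combination of these powers; the multiplier is cancelled after comparing
  values.\<close>

lemma linear_ext:
  fixes f g :: "'a \<Rightarrow> 'a"
  assumes f: "\<And>x y. x \<in> T \<Longrightarrow> y \<in> T \<Longrightarrow> f (x + y) = f x + f y"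
      "\<And>r x. r \<in> S \<Longrightarrow> x \<in> T \<Longrightarrow> f (r * x) = r * f x"
    and g: "\<And>x y. x \<in> T \<Longrightarrow> y \<in> T \<Longrightarrow> g (x + y) = g x + g y"
      "\<And>r x. r \<in> S \<Longrightarrow> x \<in> T \<Longrightarrow> g (r * x) = r * g x"
    and eq: "\<And>k. k < p \<Longrightarrow> f (t ^ k) = g (t ^ k)" and "x \<in> T"
  shows "f x = g x"
proof -
  have lin: "h (\<Sum>i\<in>A. r i * t ^ i) = (\<Sum>i\<in>A. r i * h (t ^ i))"
    if "finite A" "\<And>i. r i \<in> S" "\<And>x y. x \<in> T \<Longrightarrow> y \<in> T \<Longrightarrow> h (x + y) = h x + h y"
      "\<And>r x. r \<in> S \<Longrightarrow> x \<in> T \<Longrightarrow> h (r * x) = r * h x" for h r and A :: "nat set"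
    using that(1)
  proof induction
    case empty
    show ?case using that(4)[of 0 0] by (simp add: zero_mem base_closed)
  next
    case (insert i A)
    have "r j * t ^ j \<in> T" for j
      using that(2) base_subset by (intro closed) auto
    then have "h (r i * t ^ i + (\<Sum>i\<in>A. r i * t ^ i)) = h (r i * t ^ i) + h (\<Sum>i\<in>A. r i * t ^ i)"
      by (intro that(3) sum_mem)
    then show ?case
      using insert that(2,4) by (simp add: power_mem t_mem)
  qed
  obtain c where c: "\<And>k. c k \<in> K" "x = (\<Sum>k<p. c k * t ^ k)" by (rule powers_span) blast
  obtain u v where uv: "\<And>k. u k \<in> S" "\<And>k. v k \<in> S" "\<And>k. v k \<noteq> 0" "\<And>k. c k = u k / v k"
    using c(1) unfolding fraction_field_def mem_Collect_eq by metis
  have prodS: "prod v A \<in> S" if "finite A" for A :: "nat set"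
    using that by induction (auto simp: base_closed uv)
  define d where "d = prod v {..<p}"
  \<comment> \<open>For k < p this is \<open>d * c k\<close>, with the denominator
    \<open>v k\<close> cancelled against its factor in \<open>d\<close>.\<close>
  define r where "r k = (if k < p then u k * prod v ({..<p} - {k}) else 0)" for k
  have d: "d \<in> S" "d \<noteq> 0" using prodS uv by (auto simp: d_def)
  have rS: "r k \<in> S" for k
    using prodS uv base_closed by (simp add: r_def)
  have "d * c k = r k" if "k < p" for k
    using that uv prod.remove[of "{..<p}" k v] by (simp add: d_def r_def)
  then have dx: "d * x = (\<Sum>k<p. r k * t ^ k)"
    unfolding c(2) sum_distrib_left by (intro sum.cong) (simp_all flip: mult.assoc)
  have "d * f x = f (d * x)" using f d \<open>x \<in> T\<close> by simp
  also have "\<dots> = (\<Sum>k<p. r k * f (t ^ k))" unfolding dx by (rule lin) (use rS f in auto)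
  also have "\<dots> = (\<Sum>k<p. r k * g (t ^ k))" using eq by simp
  also have "\<dots> = g (d * x)" unfolding dx by (rule lin[symmetric]) (use rS g in auto)
  also have "\<dots> = d * g x" using g d \<open>x \<in> T\<close> by simp
  finally show ?thesis using d by simp
qed

end

section \<open>Associative algebras\<close>

text \<open>Equational laws pass from \<open>B\<close> to \<open>A\<close> because \<open>h\<close>
  is injective and respects the operations. Additive inverses are an existence claim and need the
  separate assumption \<open>neg\<close>. The lemma serves both for the Wedderburn map and for the
  inclusion of \<open>LamD\<close>.\<close>

lemma assoc_algebra_pullback:
  assumes B: "assoc_algebra R B" and inj: "inj_on h (carrier A)"
    and mem: "\<And>x. x \<in> carrier A \<Longrightarrow> h x \<in> carrier B"
    and one: "\<one>\<^bsub>A\<^esub> \<in> carrier A" "h \<one>\<^bsub>A\<^esub> = \<one>\<^bsub>B\<^esub>"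
    and zero: "\<zero>\<^bsub>A\<^esub> \<in> carrier A" "h \<zero>\<^bsub>A\<^esub> = \<zero>\<^bsub>B\<^esub>"
    and mult: "\<And>x y. x \<in> carrier A \<Longrightarrow> y \<in> carrier A \<Longrightarrow> x \<otimes>\<^bsub>A\<^esub> y \<in> carrier A"
      "\<And>x y. x \<in> carrier A \<Longrightarrow> y \<in> carrier A \<Longrightarrow> h (x \<otimes>\<^bsub>A\<^esub> y) = h x \<otimes>\<^bsub>B\<^esub> h y"
    and add: "\<And>x y. x \<in> carrier A \<Longrightarrow> y \<in> carrier A \<Longrightarrow> x \<oplus>\<^bsub>A\<^esub> y \<in> carrier A"
      "\<And>x y. x \<in> carrier A \<Longrightarrow> y \<in> carrier A \<Longrightarrow> h (x \<oplus>\<^bsub>A\<^esub> y) = h x \<oplus>\<^bsub>B\<^esub> h y"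
    and neg: "\<And>x. x \<in> carrier A \<Longrightarrow> \<exists>y\<in>carrier A. h y = \<ominus>\<^bsub>B\<^esub> h x"
    and smult: "\<And>r x. r \<in> carrier R \<Longrightarrow> x \<in> carrier A \<Longrightarrow> r \<odot>\<^bsub>A\<^esub> x \<in> carrier A"
      "\<And>r x. r \<in> carrier R \<Longrightarrow> x \<in> carrier A \<Longrightarrow> h (r \<odot>\<^bsub>A\<^esub> x) = r \<odot>\<^bsub>B\<^esub> h x"
  shows "assoc_algebra R A"
proof -
  interpret B: ring B using B by (simp add: assoc_algebra_def)
  interpret BM: module R B using B by (simp add: assoc_algebra_def)
  have alg: "(r \<odot>\<^bsub>B\<^esub> x) \<otimes>\<^bsub>B\<^esub> y = r \<odot>\<^bsub>B\<^esub> (x \<otimes>\<^bsub>B\<^esub> y)" "x \<otimes>\<^bsub>B\<^esub> (r \<odot>\<^bsub>B\<^esub> y) = r \<odot>\<^bsub>B\<^esub> (x \<otimes>\<^bsub>B\<^esub> y)"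
    if "r \<in> carrier R" "x \<in> carrier B" "y \<in> carrier B" for r x y
    using B that by (simp_all add: assoc_algebra_def)
  note eqI = inj_onD[OF inj]
  note closed = mem one zero mult add smult
  have neg_ex: "\<exists>y\<in>carrier A. y \<oplus>\<^bsub>A\<^esub> x = \<zero>\<^bsub>A\<^esub>" if x: "x \<in> carrier A" for x
  proof -
    obtain y where "y \<in> carrier A" "h y = \<ominus>\<^bsub>B\<^esub> h x" using neg[OF x] by blast
    then show ?thesis using x by (intro bexI[of _ y] eqI) (simp_all add: closed B.l_neg)
  qed
  have abelian: "abelian_group A"
  proof (rule abelian_groupI)
    show "x \<oplus>\<^bsub>A\<^esub> y \<oplus>\<^bsub>A\<^esub> z = x \<oplus>\<^bsub>A\<^esub> (y \<oplus>\<^bsub>A\<^esub> z)"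
      if "x \<in> carrier A" "y \<in> carrier A" "z \<in> carrier A" for x y z
      using that by (intro eqI) (simp_all add: closed B.a_assoc)
    show "x \<oplus>\<^bsub>A\<^esub> y = y \<oplus>\<^bsub>A\<^esub> x" if "x \<in> carrier A" "y \<in> carrier A" for x y
      using that by (intro eqI) (simp_all add: closed B.a_comm)
    show "\<zero>\<^bsub>A\<^esub> \<oplus>\<^bsub>A\<^esub> x = x" if "x \<in> carrier A" for x
      using that by (intro eqI) (simp_all add: closed)
  qed (use neg_ex in \<open>simp_all add: closed\<close>)
  have ring: "ring A"
  proof (rule ringI[OF abelian])
    show "monoid A"
    proof (rule monoidI)
      show "x \<otimes>\<^bsub>A\<^esub> y \<otimes>\<^bsub>A\<^esub> z = x \<otimes>\<^bsub>A\<^esub> (y \<otimes>\<^bsub>A\<^esub> z)"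
        if "x \<in> carrier A" "y \<in> carrier A" "z \<in> carrier A" for x y z
        using that by (intro eqI) (simp_all add: closed B.m_assoc)
      show "\<one>\<^bsub>A\<^esub> \<otimes>\<^bsub>A\<^esub> x = x" "x \<otimes>\<^bsub>A\<^esub> \<one>\<^bsub>A\<^esub> = x" if "x \<in> carrier A" for x
        using that by (auto intro!: eqI simp: closed)
    qed (simp_all add: closed)
    show "(x \<oplus>\<^bsub>A\<^esub> y) \<otimes>\<^bsub>A\<^esub> z = x \<otimes>\<^bsub>A\<^esub> z \<oplus>\<^bsub>A\<^esub> y \<otimes>\<^bsub>A\<^esub> z"
      "z \<otimes>\<^bsub>A\<^esub> (x \<oplus>\<^bsub>A\<^esub> y) = z \<otimes>\<^bsub>A\<^esub> x \<oplus>\<^bsub>A\<^esub> z \<otimes>\<^bsub>A\<^esub> y"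
      if "x \<in> carrier A" "y \<in> carrier A" "z \<in> carrier A" for x y z
      using that by (auto intro!: eqI simp: closed B.l_distr B.r_distr)
  qed
  have "module R A"
  proof (rule moduleI[OF BM.R.is_cring abelian])
    show "r \<odot>\<^bsub>A\<^esub> x \<in> carrier A" if "r \<in> carrier R" "x \<in> carrier A" for r x
      using that by (rule smult)
    show "(r \<oplus>\<^bsub>R\<^esub> q) \<odot>\<^bsub>A\<^esub> x = r \<odot>\<^bsub>A\<^esub> x \<oplus>\<^bsub>A\<^esub> q \<odot>\<^bsub>A\<^esub> x"
      if "r \<in> carrier R" "q \<in> carrier R" "x \<in> carrier A" for r q x
      using that by (intro eqI) (simp_all add: closed BM.smult_l_distr)
    show "r \<odot>\<^bsub>A\<^esub> (x \<oplus>\<^bsub>A\<^esub> y) = r \<odot>\<^bsub>A\<^esub> x \<oplus>\<^bsub>A\<^esub> r \<odot>\<^bsub>A\<^esub> y"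
      if "r \<in> carrier R" "x \<in> carrier A" "y \<in> carrier A" for r x y
      using that by (intro eqI) (simp_all add: closed BM.smult_r_distr)
    show "(r \<otimes>\<^bsub>R\<^esub> q) \<odot>\<^bsub>A\<^esub> x = r \<odot>\<^bsub>A\<^esub> (q \<odot>\<^bsub>A\<^esub> x)"
      if "r \<in> carrier R" "q \<in> carrier R" "x \<in> carrier A" for r q x
      using that by (intro eqI) (simp_all add: closed BM.smult_assoc1)
    show "\<one>\<^bsub>R\<^esub> \<odot>\<^bsub>A\<^esub> x = x" if "x \<in> carrier A" for x
      using that by (intro eqI) (simp_all add: closed)
  qed
  moreover have "(r \<odot>\<^bsub>A\<^esub> x) \<otimes>\<^bsub>A\<^esub> y = r \<odot>\<^bsub>A\<^esub> (x \<otimes>\<^bsub>A\<^esub> y)" "x \<otimes>\<^bsub>A\<^esub> (r \<odot>\<^bsub>A\<^esub> y) = r \<odot>\<^bsub>A\<^esub> (x \<otimes>\<^bsub>A\<^esub> y)"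
    if "r \<in> carrier R" "x \<in> carrier A" "y \<in> carrier A" for r x y
    using that by (auto intro!: eqI simp: closed alg)
  ultimately show ?thesis using ring by (simp add: assoc_algebra_def)
qed

lemma End_alg_simps [simp]:
  "f \<otimes>\<^bsub>End_alg S T\<^esub> g = compose T g f" "\<one>\<^bsub>End_alg S T\<^esub> = (\<lambda>x\<in>T. x)"
  "\<zero>\<^bsub>End_alg S T\<^esub> = (\<lambda>x\<in>T. 0)" "f \<oplus>\<^bsub>End_alg S T\<^esub> g = (\<lambda>x\<in>T. f x + g x)"
  "r \<odot>\<^bsub>End_alg S T\<^esub> f = (\<lambda>x\<in>T. r * f x)"
  by (simp_all add: End_alg_def)

lemma mem_End_alg:
  "f \<in> carrier (End_alg S T) \<longleftrightarrow> f \<in> extensional T \<and> (\<forall>x\<in>T. f x \<in> T) \<and>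
     (\<forall>x\<in>T. \<forall>y\<in>T. f (x + y) = f x + f y) \<and> (\<forall>r\<in>S. \<forall>x\<in>T. f (r * x) = r * f x)"
  by (auto simp: End_alg_def PiE_iff)

lemma twisted_group_ring_simps [simp]:
  "carrier (twisted_group_ring T G) = carrier G \<rightarrow>\<^sub>E T"
  "\<one>\<^bsub>twisted_group_ring T G\<^esub> = (\<lambda>\<rho>\<in>carrier G. if \<rho> = \<one>\<^bsub>G\<^esub> then 1 else 0)"
  "\<zero>\<^bsub>twisted_group_ring T G\<^esub> = (\<lambda>\<rho>\<in>carrier G. 0)"
  "y \<oplus>\<^bsub>twisted_group_ring T G\<^esub> z = (\<lambda>\<rho>\<in>carrier G. y \<rho> + z \<rho>)"
  "r \<odot>\<^bsub>twisted_group_ring T G\<^esub> y = (\<lambda>\<rho>\<in>carrier G. r * y \<rho>)"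
  "y \<otimes>\<^bsub>twisted_group_ring T G\<^esub> z = (\<lambda>\<kappa>\<in>carrier G.
     \<Sum>(\<rho>, \<tau>)\<in>{(\<rho>, \<tau>) \<in> carrier G \<times> carrier G. \<rho> \<otimes>\<^bsub>G\<^esub> \<tau> = \<kappa>}. \<tau> (y \<rho>) * z \<tau>)"
  by (simp_all add: twisted_group_ring_def)

section \<open>The image of the Wedderburn embedding\<close>

context wild_extension
begin

abbreviation "E \<equiv> End_alg S T"
abbreviation "R \<equiv> subring_rec S"
abbreviation "TG \<equiv> twisted_group_ring T G"
abbreviation "\<omega> \<equiv> wedderburn T G"

section \<open>The endomorphism algebra and pointwise formulas for its operations\<close>

lemma base_mem: "r \<in> S \<Longrightarrow> r \<in> T"
  using base_subset by auto

lemma End_eqI: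
  "f \<in> carrier E \<Longrightarrow> g \<in> carrier E \<Longrightarrow> (\<And>x. x \<in> T \<Longrightarrow> f x = g x) \<Longrightarrow> f = g"
  by (auto simp: mem_End_alg intro: extensionalityI)

lemma End_mult_closed: "f \<in> carrier E \<Longrightarrow> g \<in> carrier E \<Longrightarrow> compose T g f \<in> carrier E"
  by (simp add: mem_End_alg compose_eq compose_extensional add_mem mult_mem base_mem)

lemma End_add_closed: "f \<in> carrier E \<Longrightarrow> g \<in> carrier E \<Longrightarrow> (\<lambda>x\<in>T. f x + g x) \<in> carrier E"
  by (simp add: mem_End_alg add_mem mult_mem base_mem algebra_simps)

lemma End_smult_closed: "f \<in> carrier E \<Longrightarrow> r \<in> S \<Longrightarrow> (\<lambda>x\<in>T. r * f x) \<in> carrier E"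
  by (simp add: mem_End_alg add_mem mult_mem base_mem algebra_simps)

lemma End_neg_closed: "f \<in> carrier E \<Longrightarrow> (\<lambda>x\<in>T. - f x) \<in> carrier E"
  by (simp add: mem_End_alg add_mem mult_mem base_mem uminus_mem)

lemma End_one_closed: "(\<lambda>x\<in>T. x) \<in> carrier E"
  by (simp add: mem_End_alg add_mem mult_mem base_mem)

lemma End_zero_closed: "(\<lambda>x\<in>T. 0) \<in> carrier E"
  by (simp add: mem_End_alg add_mem mult_mem base_mem zero_mem)

lemma End_apply_mem: "f \<in> carrier E \<Longrightarrow> x \<in> T \<Longrightarrow> f x \<in> T"
  by (simp add: mem_End_alg)

lemmas End_closed = End_mult_closed End_add_closed End_smult_closed End_one_closed End_zero_closed
  End_apply_mem

lemma End_assoc_algebra: "assoc_algebra R E"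
proof -
  have abelian: "abelian_group E"
  proof (rule abelian_groupI)
    show "\<exists>g\<in>carrier E. g \<oplus>\<^bsub>E\<^esub> f = \<zero>\<^bsub>E\<^esub>" if "f \<in> carrier E" for f
      using End_neg_closed[OF that] by (intro bexI[of _ "\<lambda>x\<in>T. - f x"]) auto
    show "\<zero>\<^bsub>E\<^esub> \<oplus>\<^bsub>E\<^esub> f = f" if "f \<in> carrier E" for f
      using that End_add_closed[OF End_zero_closed that] by (intro End_eqI) simp_all
  qed (simp_all add: End_closed ac_simps cong: restrict_cong)
  have ring: "ring E"
  proof (rule ringI[OF abelian])
    show "monoid E"
    proof (rule monoidI)
      show "\<one>\<^bsub>E\<^esub> \<otimes>\<^bsub>E\<^esub> f = f" "f \<otimes>\<^bsub>E\<^esub> \<one>\<^bsub>E\<^esub> = f" if "f \<in> carrier E" for f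
        using that by (auto intro!: End_eqI simp: End_closed compose_eq)
      show "f \<otimes>\<^bsub>E\<^esub> g \<otimes>\<^bsub>E\<^esub> h = f \<otimes>\<^bsub>E\<^esub> (g \<otimes>\<^bsub>E\<^esub> h)"
        if "f \<in> carrier E" "g \<in> carrier E" "h \<in> carrier E" for f g h
        using that by (auto intro!: End_eqI simp: End_closed compose_eq)
    qed (simp_all add: End_closed)
    show "(f \<oplus>\<^bsub>E\<^esub> g) \<otimes>\<^bsub>E\<^esub> h = f \<otimes>\<^bsub>E\<^esub> h \<oplus>\<^bsub>E\<^esub> g \<otimes>\<^bsub>E\<^esub> h"
      if "f \<in> carrier E" "g \<in> carrier E" "h \<in> carrier E" for f g h
      using that by (intro End_eqI) (simp_all add: End_closed compose_eq, simp add: mem_End_alg)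
    show "h \<otimes>\<^bsub>E\<^esub> (f \<oplus>\<^bsub>E\<^esub> g) = h \<otimes>\<^bsub>E\<^esub> f \<oplus>\<^bsub>E\<^esub> h \<otimes>\<^bsub>E\<^esub> g"
      if "f \<in> carrier E" "g \<in> carrier E" "h \<in> carrier E" for f g h
      using that by (intro End_eqI) (simp_all add: End_closed compose_eq)
  qed
  have "module R E"
  proof (rule moduleI[OF base_cring abelian])
    show "\<one>\<^bsub>R\<^esub> \<odot>\<^bsub>E\<^esub> f = f" if "f \<in> carrier E" for f
      using that End_smult_closed[OF that base_closed(2)] by (intro End_eqI) simp_all
  qed (simp_all add: End_closed algebra_simps cong: restrict_cong)
  moreover have "(r \<odot>\<^bsub>E\<^esub> f) \<otimes>\<^bsub>E\<^esub> g = r \<odot>\<^bsub>E\<^esub> (f \<otimes>\<^bsub>E\<^esub> g)"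
    "f \<otimes>\<^bsub>E\<^esub> (r \<odot>\<^bsub>E\<^esub> g) = r \<odot>\<^bsub>E\<^esub> (f \<otimes>\<^bsub>E\<^esub> g)"
    if "r \<in> carrier R" "f \<in> carrier E" "g \<in> carrier E" for r f g
    using that by (intro End_eqI; simp add: End_closed compose_eq; simp add: mem_End_alg)+
  ultimately show ?thesis
    using ring by (simp only: assoc_algebra_def) blast
qed

lemma End_ring: "ring E"
  using End_assoc_algebra by (simp add: assoc_algebra_def)

lemma End_minus: "f \<in> carrier E \<Longrightarrow> \<ominus>\<^bsub>E\<^esub> f = (\<lambda>x\<in>T. - f x)"
  using End_neg_closed[of f]
  by (intro abelian_group.minus_equality[OF ring.is_abelian_group[OF End_ring]]) auto

text \<open>Together with \<open>End_finsum\<close> this turns the ring-theoretic sum in the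
  definition of \<open>LamD\<close> into a sum of values.\<close>

lemma End_add_pow:
  assumes f: "f \<in> carrier E"
  shows "add_pow E (k::int) f = (\<lambda>x\<in>T. of_int k * f x)"
proof -
  interpret ring E by (rule End_ring)
  have nat: "add_pow E n f = (\<lambda>x\<in>T. of_nat n * f x)" for n :: nat
  proof (induction n)
    case 0
    then show ?case by simp
  next
    case (Suc n)
    then show ?case using f by (simp add: algebra_simps cong: restrict_cong)
  qed
  show ?thesis
  proof (cases "k \<ge> 0")
    case True
    then show ?thesis by (simp add: add_pow_int_ge nat)
  next
    case False
    have "add_pow E (nat (- k)) f \<in> carrier E" using f by simp
    then show ?thesis using False
      by (simp add: add_pow_int_lt End_minus) (simp add: nat cong: restrict_cong)
  qed
qed

lemma End_finsum:
  assumes "finite A" and "\<And>j. j \<in> A \<Longrightarrow> F j \<in> carrier E"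
  shows "finsum E F A = (\<lambda>x\<in>T. \<Sum>j\<in>A. F j x)"
proof -
  interpret ring E by (rule End_ring)
  show ?thesis
    using assms
  proof (induction A)
    case empty
    then show ?case by simp
  next
    case (insert j A)
    then show ?case by (subst finsum_insert) (auto cong: restrict_cong)
  qed
qed

section \<open>Multiplication by powers of the uniformizer, and membership in the two orders\<close>

lemma dot_mem: "y \<in> T \<Longrightarrow> dot T y \<in> carrier E"
  by (simp add: mem_End_alg dot_def add_mem mult_mem base_mem algebra_simps)

lemma dot_pow: "dot T t [^]\<^bsub>E\<^esub> (n::nat) = dot T (t ^ n)"
proof (induction n)
  case 0
  then show ?case by (simp add: dot_def cong: restrict_cong)
next
  case (Suc n)
  then show ?case
    by (auto simp: dot_def compose_def mult_mem power_mem t_mem mult.commute mult.left_commute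
      cong: restrict_cong)
qed

lemma mem_Lam: "f \<in> Lam S T t \<longleftrightarrow> f \<in> carrier E \<and> (\<forall>i. \<forall>x\<in>P i. f x \<in> P i)"
proof -
  have "{x * t ^ i | x. x \<in> T} = P i" for i
    using P_I by (auto elim!: P_E simp: mult.commute)
  then show ?thesis by (auto simp: Lam_def image_subset_iff)
qed

text \<open>The iterated commutator of \<open>f\<close> with multiplication by \<open>t\<close>, evaluated at \<open>x\<close>.\<close>

definition bracket :: "('a \<Rightarrow> 'a) \<Rightarrow> nat \<Rightarrow> 'a \<Rightarrow> 'a" where
  "bracket f i x = (\<Sum>j\<le>i. (-1) ^ j * of_nat (i choose j) * (f (x * t ^ j) * t ^ (i - j)))"

text \<open>Products compose from left to right, so multiplication by \<open>t ^ j\<close> acts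
  before \<open>u\<close> and multiplication by \<open>t ^ (i - j)\<close> after it; this gives the
  summands of \<open>bracket\<close>. Likewise the power of \<open>t\<close> in front of
  \<open>v\<close> multiplies the argument of \<open>v\<close>.\<close>

lemma mem_LamD:
  "u \<in> LamD S T t b p \<longleftrightarrow> u \<in> Lam S T t \<and>
     (\<forall>i<p. \<exists>v\<in>Lam S T t. \<forall>x\<in>T. bracket u i x = v (x * t ^ (Suc b * i)))"
proof (cases "u \<in> Lam S T t")
  case True
  then have u: "u \<in> carrier E" by (simp add: mem_Lam)
  have summand: "compose T (dot T (t ^ (i - j))) (compose T u (dot T (t ^ j))) \<in> carrier E" for i j
    using u by (intro End_mult_closed dot_mem power_mem t_mem)
  have lhs: "(\<Oplus>\<^bsub>E\<^esub>j\<in>{0..i}. add_pow E ((-1) ^ j * int (i choose j))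
      (dot T t [^]\<^bsub>E\<^esub> j \<otimes>\<^bsub>E\<^esub> u \<otimes>\<^bsub>E\<^esub> dot T t [^]\<^bsub>E\<^esub> (i - j))) = (\<lambda>x\<in>T. bracket u i x)" for i
  proof -
    interpret ring E by (rule End_ring)
    let ?F = "\<lambda>j. add_pow E ((-1) ^ j * int (i choose j))
        (compose T (dot T (t ^ (i - j))) (compose T u (dot T (t ^ j))))"
    have "?F j \<in> carrier E" for j
      using summand by (intro add.int_pow_closed)
    then have "finsum E ?F {0..i} = (\<lambda>x\<in>T. \<Sum>j\<in>{0..i}. ?F j x)"
      by (intro End_finsum) auto
    also have "\<dots> = (\<lambda>x\<in>T. bracket u i x)"
      unfolding End_add_pow[OF summand] bracket_def atMost_atLeast0
      by (intro restrict_ext sum.cong refl)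
        (simp add: compose_eq dot_def mult_mem power_mem t_mem End_apply_mem[OF u])
    finally show ?thesis by (simp only: dot_pow End_alg_simps)
  qed
  have rhs: "(\<lambda>x\<in>T. bracket u i x) = compose T v (dot T (t ^ n)) \<longleftrightarrow>
      (\<forall>x\<in>T. bracket u i x = v (x * t ^ n))" for i n v
    by (auto simp: fun_eq_iff compose_def dot_def restrict_def split: if_splits)
  have "(\<Oplus>\<^bsub>E\<^esub>j\<in>{0..i}. add_pow E ((-1) ^ j * int (i choose j))
        (dot T t [^]\<^bsub>E\<^esub> j \<otimes>\<^bsub>E\<^esub> u \<otimes>\<^bsub>E\<^esub> dot T t [^]\<^bsub>E\<^esub> (i - j)))
      \<in> {dot T t [^]\<^bsub>E\<^esub> ((1 + b) * i) \<otimes>\<^bsub>E\<^esub> v | v. v \<in> Lam S T t} \<longleftrightarrow>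
      (\<exists>v\<in>Lam S T t. \<forall>x\<in>T. bracket u i x = v (x * t ^ (Suc b * i)))" for i
    unfolding lhs unfolding dot_pow End_alg_simps mem_Collect_eq rhs plus_1_eq_Suc by blast
  \<comment> \<open>Positivity of p matters: for p = 0 the truncated subtraction would leave the
    index 0 in the interval.\<close>
  moreover have "i \<in> {0..p - 1} \<longleftrightarrow> i < p" for i
    using p_pos by auto
  ultimately show ?thesis
    using True unfolding LamD_def mem_Collect_eq Ball_def by (simp only:)
next
  case False
  then show ?thesis by (auto simp: LamD_def)
qed

section \<open>Wedderburn images, their iterated commutators, and recovery of the
  coefficients\<close>

lemma wedderburn_apply: "x \<in> T \<Longrightarrow> \<omega> y x = (\<Sum>\<rho>\<in>carrier G. \<rho> x * y \<rho>)"
  by (simp add: wedderburn_def)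

lemma wedderburn_mem_Lam:
  assumes y: "\<And>\<rho>. \<rho> \<in> carrier G \<Longrightarrow> y \<rho> \<in> T"
  shows "\<omega> y \<in> Lam S T t"
proof -
  have "\<omega> y \<in> carrier E"
    unfolding mem_End_alg
  proof (intro conjI ballI)
    show "\<omega> y \<in> extensional T" by (simp add: wedderburn_def)
    show "\<omega> y x \<in> T" if "x \<in> T" for x
      unfolding wedderburn_apply[OF that] by (intro sum_mem mult_mem[OF G_mem[OF _ that] y])
    show "\<omega> y (x + z) = \<omega> y x + \<omega> y z" if "x \<in> T" "z \<in> T" for x z
    proof -
      have "(\<Sum>\<rho>\<in>carrier G. \<rho> (x + z) * y \<rho>) = (\<Sum>\<rho>\<in>carrier G. \<rho> x * y \<rho> + \<rho> z * y \<rho>)"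
        by (intro sum.cong refl) (simp only: G_add distrib_right)
      then show ?thesis
        by (simp only: wedderburn_apply[OF add_mem[OF that]] wedderburn_apply that sum.distrib)
    qed
    show "\<omega> y (r * x) = r * \<omega> y x" if "r \<in> S" "x \<in> T" for r x
    proof -
      have "(\<Sum>\<rho>\<in>carrier G. \<rho> (r * x) * y \<rho>) = (\<Sum>\<rho>\<in>carrier G. r * (\<rho> x * y \<rho>))"
        by (intro sum.cong refl) (simp only: G_mult G_fix_S[OF _ that(1)] mult.assoc)
      then show ?thesis
        by (simp only: wedderburn_apply[OF mult_mem[OF base_mem[OF that(1)] that(2)]]
            wedderburn_apply that sum_distrib_left)
    qed
  qed
  moreover have "\<omega> y x \<in> P i" if "x \<in> P i" for i x
  proof -
    have "\<rho> x * y \<rho> / t ^ i \<in> T" if "\<rho> \<in> carrier G" for \<rho>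
      using P_mult[OF G_P[OF that \<open>x \<in> P i\<close>], of "y \<rho>" 0] y[OF that] by (simp add: P_0 P_def)
    then show ?thesis
      using mem_P_imp_mem[OF that]
      by (simp add: wedderburn_apply P_def sum_divide_distrib sum_mem)
  qed
  ultimately show ?thesis by (simp add: mem_Lam)
qed

lemma wedderburn_mem_End: "(\<And>\<rho>. \<rho> \<in> carrier G \<Longrightarrow> y \<rho> \<in> T) \<Longrightarrow> \<omega> y \<in> carrier E"
  using wedderburn_mem_Lam by (simp add: mem_Lam)

text \<open>In the term of \<rho>, a factor \<open>t\<close> applied before \<rho> becomes
  \<open>\<rho> t\<close>, and one applied afterwards stays \<open>t\<close>. These commute in the
  field, so the signed binomial sum is a power of \<open>t - \<rho> t\<close>.\<close>

lemma bracket_wedderburn: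
  assumes "x \<in> T"
  shows "bracket (\<omega> y) i x = (\<Sum>\<rho>\<in>carrier G. \<rho> x * y \<rho> * (t - \<rho> t) ^ i)"
proof -
  have binomial: "(t - \<rho> t) ^ i = (\<Sum>j\<le>i. (-1) ^ j * of_nat (i choose j) * (\<rho> t ^ j * t ^ (i - j)))"
    for \<rho> :: "'a \<Rightarrow> 'a"
    using binomial_ring[of "- \<rho> t" t i] by (simp add: power_minus[of "\<rho> t"] mult_ac)
  have "bracket (\<omega> y) i x = (\<Sum>j\<le>i. (-1) ^ j * of_nat (i choose j) *
      ((\<Sum>\<rho>\<in>carrier G. \<rho> x * \<rho> t ^ j * y \<rho>) * t ^ (i - j)))"
    unfolding bracket_def using assms
    by (intro sum.cong refl arg_cong2[of _ _ _ _ times])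
      (simp only: wedderburn_apply mult_mem power_mem t_mem G_mult G_power cong: sum.cong)
  also have "\<dots> = (\<Sum>j\<le>i. \<Sum>\<rho>\<in>carrier G.
      \<rho> x * y \<rho> * ((-1) ^ j * of_nat (i choose j) * (\<rho> t ^ j * t ^ (i - j))))"
    by (simp add: sum_distrib_left sum_distrib_right mult_ac)
  also have "\<dots> = (\<Sum>\<rho>\<in>carrier G. \<rho> x * y \<rho> * (t - \<rho> t) ^ i)"
    by (subst sum.swap) (simp add: binomial sum_distrib_left)
  finally show ?thesis .
qed

text \<open>At 1 the automorphisms disappear from the argument, and what remains is a Vandermonde
  moment of the coefficients. Both the construction of a preimage and injectivity rest on
  this.\<close>

lemma bracket_wedderburn_one:
  "bracket (\<omega> y) i 1 = t ^ (Suc b * i) * (\<Sum>\<rho>\<in>carrier G. slope \<rho> ^ i * y \<rho>)"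
proof -
  have "bracket (\<omega> y) i 1 = (\<Sum>\<rho>\<in>carrier G. y \<rho> * (t ^ Suc b * slope \<rho>) ^ i)"
    unfolding bracket_wedderburn[OF one_mem] slope by (intro sum.cong) (simp_all add: G_one)
  also have "\<dots> = (\<Sum>\<rho>\<in>carrier G. t ^ (Suc b * i) * (slope \<rho> ^ i * y \<rho>))"
    by (simp only: power_mult_distrib power_mult) (simp only: mult_ac)
  finally show ?thesis by (simp only: sum_distrib_left)
qed

lemma wedderburn_mem_LamD:
  assumes y: "\<And>\<rho>. \<rho> \<in> carrier G \<Longrightarrow> y \<rho> \<in> T"
  shows "\<omega> y \<in> LamD S T t b p"
  unfolding mem_LamD
proof (intro conjI allI impI)
  show "\<omega> y \<in> Lam S T t" using y by (rule wedderburn_mem_Lam)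
  fix i
  \<comment> \<open>The required power of \<open>t\<close> acts before \<open>v\<close> and
    therefore appears as a power of \<open>\<rho> t\<close> in the term of \<rho>. The factor
    \<open>(t / \<rho> t) ^ Suc b\<close> compensates for this, since \<open>t - \<rho> t\<close>
    was factored with powers of \<open>t\<close>.\<close>
  define v where "v = \<omega> (\<lambda>\<rho>. y \<rho> * (slope \<rho> * (t / \<rho> t) ^ Suc b) ^ i)"
  have "t / \<rho> t \<in> T" if \<rho>: "\<rho> \<in> carrier G" for \<rho>
  proof -
    obtain \<rho>' where \<rho>': "\<rho>' \<in> carrier G" "\<rho> \<circ> \<rho>' = id" using inverse_in_G[OF \<rho>] by blast
    \<comment> \<open>This element is \<open>t / \<rho> t\<close>, because \<rho>' is the inverse of
      \<rho>.\<close>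
    have "\<rho> (\<rho>' t / t) \<in> T"
      using G_uniformizer[OF \<rho>'(1)] by (intro G_mem[OF \<rho>]) (simp add: P_def)
    then show ?thesis using \<rho>'(2) by (simp add: G_divide[OF \<rho>] pointfree_idE)
  qed
  then have "v \<in> Lam S T t"
    unfolding v_def using y by (intro wedderburn_mem_Lam mult_mem power_mem slope_mem) auto
  moreover have "bracket (\<omega> y) i x = v (x * t ^ (Suc b * i))" if x: "x \<in> T" for x
  proof -
    have "\<rho> x * y \<rho> * (t - \<rho> t) ^ i =
        \<rho> (x * t ^ (Suc b * i)) * (y \<rho> * (slope \<rho> * (t / \<rho> t) ^ Suc b) ^ i)"
      if \<rho>: "\<rho> \<in> carrier G" for \<rho>
    proof -
      have "\<rho> t \<noteq> 0" using G_eq_0_iff[OF \<rho>] t_nonzero by simp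
      then have "t - \<rho> t = \<rho> t ^ Suc b * (slope \<rho> * (t / \<rho> t) ^ Suc b)"
        by (simp add: slope power_divide del: power_Suc)
      then have "(t - \<rho> t) ^ i = \<rho> t ^ (Suc b * i) * (slope \<rho> * (t / \<rho> t) ^ Suc b) ^ i"
        by (simp only: power_mult_distrib power_mult)
      then show ?thesis by (simp only: G_mult[OF \<rho>] G_power[OF \<rho>] mult_ac)
    qed
    moreover have "x * t ^ (Suc b * i) \<in> T" using x by (intro mult_mem power_mem t_mem)
    ultimately show ?thesis
      unfolding v_def bracket_wedderburn[OF x] by (subst wedderburn_apply) (auto intro: sum.cong)
  qed
  ultimately show "\<exists>v\<in>Lam S T t. \<forall>x\<in>T. bracket (\<omega> y) i x = v (x * t ^ (Suc b * i))" by blast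
qed

lemma LamD_imp_wedderburn:
  assumes u: "u \<in> LamD S T t b p"
  shows "\<exists>y\<in>carrier TG. u = \<omega> y"
proof -
  \<comment> \<open>The prescribed moments. They are integral because the bracket at 1 is the value
    at \<open>t ^ (Suc b * i)\<close> of a map that preserves the filtration.\<close>
  define w where "w i = bracket u i 1 / t ^ (Suc b * i)" for i
  have w: "w i \<in> T" if "i < p" for i
  proof -
    obtain v where v: "v \<in> Lam S T t" "\<And>x. x \<in> T \<Longrightarrow> bracket u i x = v (x * t ^ (Suc b * i))"
      using u \<open>i < p\<close> unfolding mem_LamD by blast
    have "t ^ (Suc b * i) \<in> P (Suc b * i)" using P_I[OF one_mem, of "Suc b * i"] by simp
    with v have "bracket u i 1 \<in> P (Suc b * i)"
      by (simp add: mem_Lam one_mem del: mult_Suc)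
    then show ?thesis by (simp add: P_def w_def)
  qed
  \<comment> \<open>The coefficients arise by applying the inverse Vandermonde matrix at the slopes
    to the moments; both have entries in \<open>T\<close>.\<close>
  define y where
    "y = (\<lambda>\<rho>\<in>carrier G. \<Sum>k<p. coeff (lagrange_poly slope (carrier G) \<rho>) k * w k)"
  have y: "y \<in> carrier TG"
    using w by (auto simp: y_def intro!: sum_mem mult_mem coeff_lagrange_slope_mem)
  then have \<omega>y: "\<omega> y \<in> carrier E" by (intro wedderburn_mem_End) auto
  have uE: "u \<in> carrier E" using u by (simp add: mem_LamD mem_Lam)
  have br: "bracket u i 1 = bracket (\<omega> y) i 1" if "i < p" for i
  proof -
    have "(\<Sum>\<rho>\<in>carrier G. slope \<rho> ^ i * y \<rho>) = w i"
      using vandermonde_solve[OF finite_G inj_on_slope, of i w] that by (simp add: card_G y_def)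
    then show ?thesis
      unfolding bracket_wedderburn_one using t_nonzero by (simp add: w_def)
  qed
  have "u (t ^ k) = \<omega> y (t ^ k)" if "k < p" for k
    using that
  proof (induction k rule: less_induct)
    case (less k)
    \<comment> \<open>The brackets at 1 depend triangularly on the values at powers of
      \<open>t\<close>: the top one enters with the invertible coefficient (-1)^k, the others are
      covered by induction.\<close>
    have split: "bracket f k 1 = (\<Sum>j<k. (-1) ^ j * of_nat (k choose j) * (f (t ^ j) * t ^ (k - j)))
        + (-1) ^ k * f (t ^ k)" for f
      by (simp add: bracket_def lessThan_Suc_atMost[symmetric])
    have "(\<Sum>j<k. (-1) ^ j * of_nat (k choose j) * (u (t ^ j) * t ^ (k - j))) =
        (\<Sum>j<k. (-1) ^ j * of_nat (k choose j) * (\<omega> y (t ^ j) * t ^ (k - j)))"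
      using less by (intro sum.cong) auto
    with br[OF \<open>k < p\<close>] show ?case unfolding split by simp
  qed
  then have "u x = \<omega> y x" if "x \<in> T" for x
    using linear_ext[of u "\<omega> y" x] uE \<omega>y that by (simp add: mem_End_alg)
  then have "u = \<omega> y" using uE \<omega>y by (intro End_eqI)
  with y show ?thesis by blast
qed

lemma wedderburn_image: "\<omega> ` carrier TG = LamD S T t b p"
proof
  show "\<omega> ` carrier TG \<subseteq> LamD S T t b p"
    by (auto intro!: wedderburn_mem_LamD)
  show "LamD S T t b p \<subseteq> \<omega> ` carrier TG"
    using LamD_imp_wedderburn by blast
qed

text \<open>An image determines its brackets at 1, hence all moments of the coefficients, and the
  inverse Vandermonde matrix recovers the coefficients. This is an explicit form of the linear
  independence of automorphisms.\<close>

lemma wedderburn_inj: "inj_on \<omega> (carrier TG)"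
proof (rule inj_onI)
  fix y z assume y: "y \<in> carrier TG" and z: "z \<in> carrier TG" and eq: "\<omega> y = \<omega> z"
  have moments: "(\<Sum>\<rho>\<in>carrier G. slope \<rho> ^ i * y \<rho>) = (\<Sum>\<rho>\<in>carrier G. slope \<rho> ^ i * z \<rho>)" for i
    using eq bracket_wedderburn_one[of y i] bracket_wedderburn_one[of z i] t_nonzero by simp
  have "y \<rho> = z \<rho>" if "\<rho> \<in> carrier G" for \<rho>
    using vandermonde_recover[OF finite_G inj_on_slope that, of y]
      vandermonde_recover[OF finite_G inj_on_slope that, of z] by (simp add: moments)
  with y z show "y = z"
    by (auto intro: extensionalityI[of _ "carrier G"] simp: PiE_iff)
qed

section \<open>Compatibility with the algebra structures\<close>

lemma TG_mult_closed:
  assumes "y \<in> carrier TG" and "z \<in> carrier TG"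
  shows "y \<otimes>\<^bsub>TG\<^esub> z \<in> carrier TG"
proof -
  have "\<tau> (y \<rho>) * z \<tau> \<in> T" if "\<rho> \<in> carrier G" "\<tau> \<in> carrier G" for \<rho> \<tau>
    using assms that by (intro mult_mem G_mem[OF that(2)]) auto
  then show ?thesis by (auto intro!: sum_mem)
qed

lemma wedderburn_mult:
  assumes "y \<in> carrier TG" and "z \<in> carrier TG"
  shows "\<omega> (y \<otimes>\<^bsub>TG\<^esub> z) = \<omega> y \<otimes>\<^bsub>E\<^esub> \<omega> z"
proof (rule End_eqI)
  show "\<omega> (y \<otimes>\<^bsub>TG\<^esub> z) \<in> carrier E"
    using TG_mult_closed[OF assms] by (intro wedderburn_mem_End) auto
  have yz: "\<omega> y \<in> carrier E" "\<omega> z \<in> carrier E"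
    using assms by (auto intro!: wedderburn_mem_End)
  then show "\<omega> y \<otimes>\<^bsub>E\<^esub> \<omega> z \<in> carrier E"
    by (simp add: End_mult_closed)
  fix x assume x: "x \<in> T"
  let ?Q = "\<lambda>\<kappa>. {q \<in> carrier G \<times> carrier G. snd q \<circ> fst q = \<kappa>}"
  let ?h = "\<lambda>q. snd q (fst q x) * (snd q (y (fst q)) * z (snd q))"
  have "(\<omega> y \<otimes>\<^bsub>E\<^esub> \<omega> z) x = (\<Sum>\<tau>\<in>carrier G. \<tau> (\<Sum>\<rho>\<in>carrier G. \<rho> x * y \<rho>) * z \<tau>)"
    using x End_apply_mem[OF yz(1) x] by (simp add: compose_eq wedderburn_apply)
  also have "\<dots> = (\<Sum>\<tau>\<in>carrier G. \<Sum>\<rho>\<in>carrier G. ?h (\<rho>, \<tau>))"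
    by (intro sum.cong refl) (simp only: G_sum G_mult sum_distrib_right mult.assoc fst_conv snd_conv)
  also have "\<dots> = (\<Sum>q\<in>carrier G \<times> carrier G. ?h q)"
    by (subst sum.swap) (simp add: sum.cartesian_product case_prod_beta)
  \<comment> \<open>The pairs are collected by their group product, in which the first component
    acts first; this matches the convolution defining the twisted product.\<close>
  also have "\<dots> = (\<Sum>\<kappa>\<in>carrier G. \<Sum>q\<in>?Q \<kappa>. ?h q)"
    by (rule sum.group[symmetric]) (auto simp: finite_G comp_mem)
  also have "\<dots> = (\<Sum>\<kappa>\<in>carrier G. \<kappa> x * (y \<otimes>\<^bsub>TG\<^esub> z) \<kappa>)"
  proof (rule sum.cong)
    fix \<kappa> assume \<kappa>: "\<kappa> \<in> carrier G"
    have Q: "{(\<rho>, \<tau>) \<in> carrier G \<times> carrier G. \<rho> \<otimes>\<^bsub>G\<^esub> \<tau> = \<kappa>} = ?Q \<kappa>"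
      by auto
    have "(\<Sum>q\<in>?Q \<kappa>. ?h q) = (\<Sum>q\<in>?Q \<kappa>. \<kappa> x * (snd q (y (fst q)) * z (snd q)))"
      by (intro sum.cong) auto
    also have "\<dots> = \<kappa> x * (y \<otimes>\<^bsub>TG\<^esub> z) \<kappa>"
      unfolding twisted_group_ring_simps restrict_apply'[OF \<kappa>] unfolding Q
      by (simp only: sum_distrib_left case_prod_unfold)
    finally show "(\<Sum>q\<in>?Q \<kappa>. ?h q) = \<kappa> x * (y \<otimes>\<^bsub>TG\<^esub> z) \<kappa>" .
  qed simp
  finally show "\<omega> (y \<otimes>\<^bsub>TG\<^esub> z) x = (\<omega> y \<otimes>\<^bsub>E\<^esub> \<omega> z) x"
    using x by (simp only: wedderburn_apply)
qed

lemma wedderburn_add: "\<omega> (y \<oplus>\<^bsub>TG\<^esub> z) = \<omega> y \<oplus>\<^bsub>E\<^esub> \<omega> z"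
  by (auto simp: wedderburn_def distrib_left sum.distrib cong: restrict_cong)

lemma wedderburn_one: "\<omega> \<one>\<^bsub>TG\<^esub> = \<one>\<^bsub>E\<^esub>"
  using id_mem finite_G
  by (auto simp: wedderburn_def if_distrib[of "\<lambda>u. _ * u"] cong: restrict_cong if_cong)

lemma wedderburn_zero: "\<omega> \<zero>\<^bsub>TG\<^esub> = \<zero>\<^bsub>E\<^esub>"
  by (simp add: wedderburn_def)

lemma wedderburn_smult: "\<omega> (r \<odot>\<^bsub>TG\<^esub> y) = r \<odot>\<^bsub>E\<^esub> \<omega> y"
  by (auto simp: wedderburn_def sum_distrib_left mult.left_commute cong: restrict_cong)

lemma wedderburn_neg:
  assumes "y \<in> carrier TG"
  shows "\<exists>z\<in>carrier TG. \<omega> z = \<ominus>\<^bsub>E\<^esub> \<omega> y"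
proof (rule bexI)
  show "\<omega> (\<lambda>\<rho>\<in>carrier G. - y \<rho>) = \<ominus>\<^bsub>E\<^esub> \<omega> y"
    using assms wedderburn_mem_End[of y]
    by (auto simp: End_minus PiE_iff) (auto simp: wedderburn_def sum_negf cong: restrict_cong)
  show "(\<lambda>\<rho>\<in>carrier G. - y \<rho>) \<in> carrier TG"
    using assms by (auto intro: uminus_mem)
qed

lemma TG_closed:
  "\<one>\<^bsub>TG\<^esub> \<in> carrier TG" "\<zero>\<^bsub>TG\<^esub> \<in> carrier TG"
  "y \<in> carrier TG \<Longrightarrow> z \<in> carrier TG \<Longrightarrow> y \<oplus>\<^bsub>TG\<^esub> z \<in> carrier TG"
  "r \<in> S \<Longrightarrow> y \<in> carrier TG \<Longrightarrow> r \<odot>\<^bsub>TG\<^esub> y \<in> carrier TG"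
  by (auto simp: zero_mem one_mem add_mem mult_mem base_mem PiE_iff)

text \<open>The axioms, in particular associativity of the twisted multiplication, are inherited
  from the endomorphism algebra along the injective map \<omega>.\<close>

lemma TG_assoc_algebra: "assoc_algebra R TG"
proof (rule assoc_algebra_pullback[OF End_assoc_algebra wedderburn_inj])
  show "\<omega> y \<in> carrier E" if "y \<in> carrier TG" for y
    using that by (intro wedderburn_mem_End) auto
qed (simp_all only: TG_closed TG_mult_closed wedderburn_mult wedderburn_add wedderburn_one
    wedderburn_zero wedderburn_smult wedderburn_neg subring_rec_simps)

lemma wedderburn_hom: "\<omega> \<in> algebra_hom R TG E"
proof -
  have "\<omega> \<in> carrier TG \<rightarrow> carrier E" by (auto intro!: wedderburn_mem_End)
  then show ?thesis
    unfolding algebra_hom_def ring_hom_def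
    using wedderburn_mult wedderburn_add wedderburn_one wedderburn_smult
    by (simp del: twisted_group_ring_simps End_alg_simps)
qed

text \<open>Closure under the operations is obtained from the description of \<open>LamD\<close> as
  the image of \<omega>, rather than from the commutator conditions.\<close>

lemma LamD_assoc_algebra: "assoc_algebra R (E\<lparr>carrier := LamD S T t b p\<rparr>)"
proof (rule assoc_algebra_pullback[OF End_assoc_algebra, of "\<lambda>f. f"])
  let ?D = "E\<lparr>carrier := LamD S T t b p\<rparr>"
  have D: "carrier ?D = \<omega> ` carrier TG" unfolding wedderburn_image by simp
  show "f \<in> carrier E" if "f \<in> carrier ?D" for f
    using that by (simp add: LamD_def Lam_def)
  show "\<one>\<^bsub>?D\<^esub> \<in> carrier ?D"
    unfolding D using TG_closed(1) wedderburn_one by (intro image_eqI[of _ _ "\<one>\<^bsub>TG\<^esub>"]) simp_all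
  show "\<zero>\<^bsub>?D\<^esub> \<in> carrier ?D"
    unfolding D using TG_closed(2) wedderburn_zero by (intro image_eqI[of _ _ "\<zero>\<^bsub>TG\<^esub>"]) simp_all
  show "f \<otimes>\<^bsub>?D\<^esub> g \<in> carrier ?D" "f \<oplus>\<^bsub>?D\<^esub> g \<in> carrier ?D"
    if fg: "f \<in> carrier ?D" "g \<in> carrier ?D" for f g
  proof -
    obtain y z where yz: "y \<in> carrier TG" "z \<in> carrier TG" "f = \<omega> y" "g = \<omega> z"
      using fg unfolding D by blast
    show "f \<otimes>\<^bsub>?D\<^esub> g \<in> carrier ?D"
      unfolding D using yz wedderburn_mult[OF yz(1,2)] TG_mult_closed[OF yz(1,2)]
      by (intro image_eqI[of _ _ "y \<otimes>\<^bsub>TG\<^esub> z"]) simp_all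
    show "f \<oplus>\<^bsub>?D\<^esub> g \<in> carrier ?D"
      unfolding D using yz wedderburn_add[of y z] TG_closed(3)[OF yz(1,2)]
      by (intro image_eqI[of _ _ "y \<oplus>\<^bsub>TG\<^esub> z"]) simp_all
  qed
  show "\<exists>g\<in>carrier ?D. g = \<ominus>\<^bsub>E\<^esub> f" if "f \<in> carrier ?D" for f
    using that wedderburn_neg unfolding D by force
  show "r \<odot>\<^bsub>?D\<^esub> f \<in> carrier ?D" if rf: "r \<in> carrier R" "f \<in> carrier ?D" for r f
  proof -
    obtain y where y: "y \<in> carrier TG" "f = \<omega> y" using rf unfolding D by blast
    show ?thesis
      unfolding D using y wedderburn_smult[of r y] TG_closed(4)[OF _ y(1), of r] rf(1)
      by (intro image_eqI[of _ _ "r \<odot>\<^bsub>TG\<^esub> y"]) simp_all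
  qed
qed simp_all

lemma wedderburn_iso: "\<omega> \<in> algebra_iso R TG (E\<lparr>carrier := LamD S T t b p\<rparr>)"
proof -
  have "bij_betw \<omega> (carrier TG) (LamD S T t b p)"
    using wedderburn_inj wedderburn_image by (simp add: bij_betw_def)
  with wedderburn_hom show ?thesis
    unfolding algebra_iso_def algebra_hom_def ring_hom_def
    by (auto simp del: twisted_group_ring_simps End_alg_simps simp: bij_betwE)
qed

end

theorem theorem1p19:
  fixes S T K :: "'a::field set"
    and G :: "('a \<Rightarrow> 'a) monoid"
    and \<sigma> :: "'a \<Rightarrow> 'a"
    and s t :: 'a
    and p b b_quot b_rem :: nat
  assumes "Factorial_Ring.prime p" and "p \<ge> 3"
    and "dvr S" and "dvr T" and "S \<subseteq> T"
    and "residue_char S p" and "residue_char T p"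
    and "finite_over S T" and "purely_ramified S T"
    and "K = fraction_field S" and "fraction_field T = (UNIV :: 'a set)"
    and "galois_over K" and "G = galois_group K"
    and "\<sigma> \<in> carrier G" and "generate G {\<sigma>} = carrier G" and "Coset.order G = p"
    and "uniformizer T t" and "s = galois_norm K t"
    and "val T t (\<sigma> t - t) = enat (b + 1)" and "b \<ge> 1"
    and "b = p * b_quot + b_rem" and "b_rem \<in> {0..p - 1}"
    and "val S s (of_nat p) \<ge> enat (b - b_quot)"
  shows "assoc_algebra (subring_rec S) (twisted_group_ring T G) \<and>
     assoc_algebra (subring_rec S) (End_alg S T) \<and>
     wedderburn T G \<in> algebra_hom (subring_rec S) (twisted_group_ring T G) (End_alg S T) \<and>
     LamD S T t b p \<subseteq> Lam S T t \<and> Lam S T t \<subseteq> carrier (End_alg S T) \<and>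
     assoc_algebra (subring_rec S) ((End_alg S T)\<lparr>carrier := LamD S T t b p\<rparr>) \<and>
     wedderburn T G \<in> algebra_iso (subring_rec S) (twisted_group_ring T G)
           ((End_alg S T)\<lparr>carrier := LamD S T t b p\<rparr>) \<and>
     wedderburn T G ` carrier (twisted_group_ring T G) = LamD S T t b p"
proof -
  interpret V: valuation_ring T t
    using assms by (intro dvr_valuation_ring)
  have max: "max_ideal T = V.P 1"
    using assms by (intro V.max_ideal_eq_P)
  have G: "G = galois_group (fraction_field S)" using assms by simp
  have "p > 0" using assms by simp
  interpret S: principal_domain "subring_rec S"
    using assms by (simp add: dvr_def)
  interpret W: wild_extension T t S \<sigma> p b
  proof
    show "S \<subseteq> T" by fact
    show "finite_over S T" by fact
    show "b \<ge> 1" by fact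
    show "p > 0" by fact
    show "{x. \<forall>\<rho>\<in>carrier (galois_group (fraction_field S)). \<rho> x = x} = fraction_field S"
      using assms by (simp add: galois_over_def)
    show "Coset.order (galois_group (fraction_field S)) = p"
      using assms by simp
    show "carrier (galois_group (fraction_field S)) = range (\<lambda>k. \<sigma> ^^ k)"
    proof -
      have "finite (carrier G)"
        using \<open>Coset.order G = p\<close> \<open>p > 0\<close> by (auto simp: Coset.order_def intro: card_ge_0_finite)
      \<comment> \<open>In a finite group the subgroup generated by one element consists of its
        natural powers, so negative exponents do not arise.\<close>
      then have "carrier G = {\<sigma> [^]\<^bsub>G\<^esub> k | k. k \<in> (UNIV :: nat set)}"
        using group.generate_pow_on_finite_carrier[OF group_galois_group, of K \<sigma>]
          \<open>G = galois_group K\<close> \<open>\<sigma> \<in> carrier G\<close> \<open>generate G {\<sigma>} = carrier G\<close> by simp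
      then show ?thesis by (auto simp: G galois_group_pow)
    qed
    show "\<exists>y\<in>S. x - y \<in> V.P 1" if "x \<in> T" for x
      using assms that by (auto simp: purely_ramified_def trivial_residue_extension_def max)
    show "of_nat n \<in> V.P 1 \<longleftrightarrow> p dvd n" for n
      using assms by (simp add: residue_char_def max)
    show "\<sigma> t - t \<in> V.P (Suc b)" "\<sigma> t - t \<notin> V.P (Suc (Suc b))"
      using V.val_eq_SucD[of "\<sigma> t - t" b] assms by simp_all
  qed
  show ?thesis
    unfolding G
    using W.TG_assoc_algebra W.End_assoc_algebra W.wedderburn_hom W.LamD_assoc_algebra
      W.wedderburn_iso W.wedderburn_image
    by (auto simp: LamD_def Lam_def)
qed

end
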